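(* In the cybersecurity provisioning model described in the context, let the algorithm described in the context be run with inputs as specified there, and let $\mathcal V_0(0,\mathrm{no})$, $\pi^\star$, $(P^\star_t)_{t=1}^T$, $(\overline P^\star_t)_{t=0}^T$, $(\overline\zeta^{(m)}_t)_{t=1,\dots,T;\,m=1,\dots,M}$ and $(\overline Z_{\zeta^{(m)}})_{m=1,\dots,M}$ be its outputs. Then the following hold. (i) $\mathcal V_0(0,\mathrm{no})=\mathbb V_0$ and $\pi^\star$ is an optimal decision policy, i.e. $\pi^\star\in\Pi$ and $\mathcal V_0(0,\mathrm{no})=V^{\pi^\star}_0=\mathbb V_0$. (ii) $(P^\star_t)_{t=1}^T$ are the transition kernels of $(b^{\pi^\star}_t,i^{\pi^\star}_t)_{t=0}^T$, i.e. for $t=1,\dots,T$ and all $(b,i),(b',i')\in\mathcal B\times\mathcal I$ such that $\mathbb P[(b^{\pi^\star}_{t-1},i^{\pi^\star}_{t-1})=(b,i)]>0$, $$P^\star_t[(b,i)\to(b',i')]=\mathbb P\big[(b^{\pi^\star}_t,i^{\pi^\star}_t)=(b',i')\,\big|\,(b^{\pi^\star}_{t-1},i^{\pi^\star}_{t-1})=(b,i)\big];$$ and $(\overline P^\star_t)_{t=0}^T$ are the marginal state occupancy probabilities, i.e. $\overline P^\star_t(b,i)=\mathbb P[(b^{\pi^\star}_t,i^{\pi^\star}_t)=(b,i)]$ for all $(b,i)\in\mathcal B\times\mathcal I$ and $t=0,\dots,T$. (iii) For $t=1,\dots,T$ and $m=1,\dots,M$, $\overline\zeta^{(m)}_t=\mathbb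 E\big[\zeta^{(m)}_t(b^{\pi^\star}_{t-1},i^{\pi^\star}_{t-1},W_t)\big]$, and $\overline Z_{\zeta^{(m)}}=\sum_{t=1}^T\mathbb E\big[\zeta^{(m)}_t(b^{\pi^\star}_{t-1},i^{\pi^\star}_{t-1},W_t)\big]$.
   Context: Notation: $\mathbb R_+=[0,\infty)$, $\mathbb Z_+=\{0,1,2,\dots\}$, $(x)^+=\max\{x,0\}$, $x\wedge y=\min\{x,y\}$; $\mathbf 1$ denotes an indicator. $T\ge 1$ is the number of years. Loss model. $\mathcal W:=\bigcup_{n\in\mathbb Z_+}\{n\}\times\mathbb R_+^n$, with the $\sigma$-algebra $\mathfrak B(\mathcal W)$ generated by the sets $\{n\}\times B$, $n\in\mathbb Z_+$, $B\subseteq\mathbb R^n_+$ Borel. For $t=1,\dots,T$, $\mathbb P_t$ is a probability measure on $(\mathcal W,\mathfrak B(\mathcal W))$; $\Omega:=\mathcal W^T$, $\mathbb P:=\mathbb P_1\otimes\cdots\otimes\mathbb P_T$. $W_t(\omega):=w_t$ for $\omega=(w_1,\dots,w_T)$, so that $W_1,\dots,W_T$ are independent, and one writes $W_t=(N_t,X^{(t)}_1,\dots,X^{(t)}_{N_t})$. $\mathcal F_0:=\{\emptyset,\Omega\}$ and $\mathcal F_t:=\sigma(W_1,\dots,W_t)$. It is assumed that for each $t$ there is a distribution function $F_{X^{(t)}}$ on $\mathbb R_+$ with finite expectation such that $\mathbb P[N_t=n,\ X^{(t)}_k\le z_k\ \forall 1\le k\le n]=\mathbb P[N_t=n]\prod_{k=1}^nF_{X^{(t)}}(z_k)$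 for all $n$ and $z_1,\dots,z_n$. Self-mitigation. $\mathcal D:=\{0,1,\dots,D\}$ with $D\in\mathbb N$; $\beta,\gamma:\mathcal D\to\mathbb R_+$ with $\beta(0)=\gamma(0)=0$. For $w=(n,x_1,\dots,x_n)\in\mathcal W$, $L(d,w):=\sum_{k=1}^n(x_k-\gamma(d))^+$. Insurance with Bonus-Malus. $\mathcal B:=\{-\underline B,\dots,-1,0,1,\dots,\overline B\}$ (a finite set of consecutive integers containing $0$); $\mathcal I:=\{\mathrm{no},\mathrm{on},\mathrm{off}_1,\dots,\mathrm{off}_T\}$ (contract states). $\mathcal{BM}:\mathcal B\times\mathbb R_+\to\mathcal B$ is a function with $\mathcal{BM}(b,\cdot)$ non-decreasing for every $b$; $\mathcal{BM}_0:\mathcal B\times\mathcal I\to\mathcal B\times\mathcal I$ is a function with $\mathcal{BM}_0(b,\mathrm{no})=(b,\mathrm{no})$ for all $b$. Deterministic functions: premium $p:\mathcal B\times\{1,\dots,T\}\to\mathbb R_+$, increasing in the first argument; deductible $l_{\mathrm{dtb}}$ and maximum compensation $l_{\max}$, both $\mathcal B\times\{1,\dots,T\}\to\mathbb R_+$; fees $\delta_{\mathrm{in}}(t)\ge0$, $\delta_{\mathrm{out}}(t)\ge0$ and a constant $\delta_{\mathrm{re}}\ge0$. Compensation: $\lambda(b,t,l):=(l-l_{\mathrm{dtb}}(b,t))^+\wedge l_{\max}(b,t)$ for $l\ge0$. Control problem. For $t=1,\dots,T$ and $(b,i,d,\iota,j,w)\in\mathcal B\times\mathcal I\times\mathcal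 D\times\{0,1\}\times\{0,1\}\times\mathcal W$, $$f_t(b,i,d,\iota,j,w):=\begin{cases}\big(\mathcal{BM}(b,j\lambda(b,t,L(d,w))),\mathrm{on}\big)&\iota=1,\\ \mathcal{BM}_0(b,i)&\iota=0,\end{cases}$$ $$g_t(b,i,d,\iota,j,w):=\beta(d)+\iota p(b,t)+\delta_{\mathrm{in}}(t)\mathbf 1_{\{i=\mathrm{no},\iota=1\}}+\delta_{\mathrm{out}}(t)\mathbf 1_{\{i=\mathrm{on},\iota=0\}}+\delta_{\mathrm{re}}\mathbf 1_{\{i\ne\mathrm{on},i\ne\mathrm{no},\iota=1\}}+L(d,w)-\iota j\lambda(b,t,L(d,w)).$$ $\Pi$ is the set of all $\pi=(d_t,\iota_t,j_t)_{t=1}^T$ such that, for each $t$, $d_t:\Omega\to\mathcal D$ and $\iota_t:\Omega\to\{0,1\}$ are $\mathcal F_{t-1}$-measurable, $j_t:\Omega\to\{0,1\}$ is $\mathcal F_t$-measurable, and $\{\iota_t=0,j_t=1\}=\emptyset$. For $\pi\in\Pi$: $(b^\pi_0,i^\pi_0):=(0,\mathrm{no})$ and $(b^\pi_t,i^\pi_t):=f_t(b^\pi_{t-1},i^\pi_{t-1},d_t,\iota_t,j_t,W_t)$. With $r\ge 0$ and discount factor $0<e^{-r}\le1$, $$V^\pi_t:=\mathbb E\Big[\sum_{s=t+1}^Te^{-(s-t)r}g_s(b^\pi_{s-1},i^\pi_{s-1},d_s,\iota_s,j_s,W_s)\Big|\mathcal F_t\Big],\qquad V^\pi_T:=0,\qquad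 \mathbb V_0:=\inf_{\pi\in\Pi}V^\pi_0.$$ Quantities of interest. $\zeta^{(m)}_t:\mathcal B\times\mathcal I\times\mathcal W\to\mathbb R$, $t=1,\dots,T$, $m=1,\dots,M$, are given functions (measurable in the last argument) with $\mathbb E[|\zeta^{(m)}_t(b,i,W_t)|]<\infty$ for all $(b,i)\in\mathcal B\times\mathcal I$. The algorithm. Inputs: the set $\mathcal B=\{-\underline B,\dots,\overline B\}$ of Bonus-Malus levels; the set $\mathcal I=\{\mathrm{no},\mathrm{on},\mathrm{off}_1,\dots,\mathrm{off}_T\}$ of contract states; the set $\mathcal D=\{0,1,\dots,D\}$ of self-mitigation measures; the transition function $\mathcal{BM}:\mathcal B\times\mathbb R_+\to\mathcal B$, non-decreasing in its second argument; the transition function $\mathcal{BM}_0:\mathcal B\times\mathcal I\to\mathcal B\times\mathcal I$ with $\mathcal{BM}_0(b,\mathrm{no})=(b,\mathrm{no})$ for all $b\in\mathcal B$; the premium $p:\mathcal B\times\{1,\dots,T\}\to\mathbb R_+$, increasing in the first argument; the deductible and the maximum compensation $l_{\mathrm{dtb}},l_{\max}:\mathcal B\times\{1,\dots,T\}\to\mathbb R_+$; the functions $\beta,\gamma:\mathcal D\to\mathbb R_+$ with $\beta(0)=\gamma(0)=0$; the fees $\delta_{\mathrm{in}}(t)\ge0$, $\delta_{\mathrm{out}}(t)\ge0$ ($t=1,\dots,T$) and $\delta_{\mathrm{re}}\ge0$; the number $r\ge0$ determining the discount factor $e^{-r}$; and the functions $\zeta^{(m)}_t:\mathcal B\times\mathcal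 I\times\mathcal W\to\mathbb R$ ($t=1,\dots,T$, $m=1,\dots,M$), measurable in the last argument, with $\mathbb E[|\zeta^{(m)}_t(b,i,W_t)|]<\infty$ for all $(b,i)\in\mathcal B\times\mathcal I$. All expectations and probabilities in the steps are taken exactly, and the values $\mathcal V_t(b,i)$ are finite (they are elements of $[0,\infty)$). Step 0: $\mathcal V_T(b,i):=0$ for all $(b,i)$. Step 1: for $t=T,T-1,\dots,1$, for each $b\in\mathcal B$: - Set $\underline b:=\mathcal{BM}(b,0)$, $\overline b:=\max\{\mathcal{BM}(b,c):c\in\mathbb R_+\}$. For each $\underline b\le b'\le\overline b$ set $\alpha_t(b,b'):=\mathcal V_t(b',\mathrm{on})-\mathcal V_t(\underline b,\mathrm{on})$ and $\mathcal L_t(b,b'):=\{c\in\mathbb R_+:\mathcal{BM}(b,c)=b',\ c>\alpha_t(b,b')\}$. - For each $i\in\mathcal I$, $d\in\mathcal D$ set $H_t(b,i,d,0):=\mathcal V_t(\mathcal{BM}_0(b,i))$ and $$H_t(b,i,d,1):=\mathcal V_t(\underline b,\mathrm{on})-\sum_{\underline b\le b'\le\overline b}\mathbb E\Big[\mathbf 1_{\{\mathcal{BM}(b,\lambda(b,t,L(d,W_t)))=b'\}}\big(\lambda(b,t,L(d,W_t))-\alpha_t(b,b')\big)^+\Big].$$ - For each $i\in\mathcal I$, let $$G_t(b,i,d,\iota):=\beta(d)+\iota p(b,t)+\delta_{\mathrm{in}}(t)\mathbf 1_{\{i=\mathrm{no},\iota=1\}}+\delta_{\mathrm{out}}(t)\mathbf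 1_{\{i=\mathrm{on},\iota=0\}}+\delta_{\mathrm{re}}\mathbf 1_{\{i\ne\mathrm{on},i\ne\mathrm{no},\iota=1\}}+\mathbb E[L(d,W_t)]+H_t(b,i,d,\iota);$$ let $(\widehat d_t(b,i),\widehat\iota_t(b,i))$ be a minimiser of $G_t(b,i,d,\iota)$ over $(d,\iota)\in\mathcal D\times\{0,1\}$; set $\mathcal V_{t-1}(b,i):=e^{-r}\min_{d\in\mathcal D,\iota\in\{0,1\}}G_t(b,i,d,\iota)$; and for $w\in\mathcal W$ set $\widehat j_t(b,i,w):=1$ if $\widehat\iota_t(b,i)=1$ and $\lambda(b,t,L(\widehat d_t(b,i),w))\in\bigcup_{\underline b\le b'\le\overline b}\mathcal L_t(b,b')$, and $\widehat j_t(b,i,w):=0$ otherwise. - For each $i\in\mathcal I$, initialise $P^\star_t[(b,i)\to(b',i')]:=0$ for all $(b',i')$. If $\widehat\iota_t(b,i)=1$, set $P^\star_t[(b,i)\to(b',\mathrm{on})]:=\mathbb P[\lambda(b,t,L(\widehat d_t(b,i),W_t))\in\mathcal L_t(b,b')]$ for $\underline b<b'\le\overline b$, and $P^\star_t[(b,i)\to(\underline b,\mathrm{on})]:=1-\sum_{\underline b<b'\le\overline b}P^\star_t[(b,i)\to(b',\mathrm{on})]$. If $\widehat\iota_t(b,i)=0$, set $P^\star_t[(b,i)\to\mathcal{BM}_0(b,i)]:=1$. Step 2: $\overline P^\star_0(0,\mathrm{no}):=1$ and $\overline P^\star_0(b,i):=0$ for $(b,i)\ne(0,\mathrm{no})$.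 For $t=1,\dots,T$: $\overline P^\star_t(b,i):=\sum_{(b',i')\in\mathcal B\times\mathcal I}P^\star_t[(b',i')\to(b,i)]\,\overline P^\star_{t-1}(b',i')$ and $\overline\zeta^{(m)}_t:=\sum_{(b,i)\in\mathcal B\times\mathcal I}\mathbb E[\zeta^{(m)}_t(b,i,W_t)]\,\overline P^\star_{t-1}(b,i)$. Then $\overline Z_{\zeta^{(m)}}:=\sum_{t=1}^T\overline\zeta^{(m)}_t$. Step 3: $\pi^\star=(d^\star_t,\iota^\star_t,j^\star_t)_{t=1}^T$ is defined recursively together with its controlled process by $(b^{\pi^\star}_0,i^{\pi^\star}_0):=(0,\mathrm{no})$, $d^\star_t:=\widehat d_t(b^{\pi^\star}_{t-1},i^{\pi^\star}_{t-1})$, $\iota^\star_t:=\widehat\iota_t(b^{\pi^\star}_{t-1},i^{\pi^\star}_{t-1})$, $j^\star_t:=\widehat j_t(b^{\pi^\star}_{t-1},i^{\pi^\star}_{t-1},W_t)$. *)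

theory Defs
  imports "HOL-Probability.Probability"
begin

section \<open>Losses\<close>

text \<open>
  A yearly loss \<open>w = (n, x)\<close> consists of the number \<open>n\<close> of incidents and their severities
  \<open>x 1, \<dots>, x n\<close>; \<open>x\<close> is extensional, i.e. \<open>undefined\<close> outside \<open>{1..n}\<close>, so that \<open>loss_set\<close> is
  the disjoint union of the sets \<open>{n} \<times> [0,\<infinity>)^n\<close>.  The Borel sets of \<open>[0,\<infinity>)^n\<close> are the
  measurable sets of the finite product space.
\<close>

type_synonym loss = "nat \<times> (nat \<Rightarrow> real)"
type_synonym scenario = "nat \<Rightarrow> loss"

definition loss_set :: "loss set" where
  "loss_set = (SIGMA n:UNIV. {1..n} \<rightarrow>\<^sub>E {0..})"

definition loss_space :: "loss measure" where
  "loss_space = sigma loss_set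
     {{n} \<times> A | n A. A \<in> sets (PiM {1..n} (\<lambda>_. restrict_space borel {0..}))}"


section \<open>The model\<close>

datatype contract = No | On | Off nat

record cyber_model =
  horizon :: nat                                        \<comment> \<open>\<open>T\<close>\<close>
  yearly_law :: "nat \<Rightarrow> loss measure"                   \<comment> \<open>\<open>P_t\<close>\<close>
  mitig_max :: nat                                      \<comment> \<open>\<open>D\<close>\<close>
  mitig_cost :: "nat \<Rightarrow> real"                           \<comment> \<open>\<open>\<beta>\<close>\<close>
  mitig_effect :: "nat \<Rightarrow> real"                         \<comment> \<open>\<open>\<gamma>\<close>\<close>
  lvl_below :: nat                                      \<comment> \<open>the lowest level is \<open>- lvl_below\<close>\<close>
  lvl_above :: nat                                      \<comment> \<open>the highest level is \<open>lvl_above\<close>\<close>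
  BM :: "int \<Rightarrow> real \<Rightarrow> int"
  BM0 :: "int \<Rightarrow> contract \<Rightarrow> int \<times> contract"
  premium :: "int \<Rightarrow> nat \<Rightarrow> real"
  deductible :: "int \<Rightarrow> nat \<Rightarrow> real"
  max_comp :: "int \<Rightarrow> nat \<Rightarrow> real"
  fee_in :: "nat \<Rightarrow> real"
  fee_out :: "nat \<Rightarrow> real"
  fee_re :: real
  rate :: real                                          \<comment> \<open>\<open>r\<close>\<close>

definition levels :: "cyber_model \<Rightarrow> int set" where
  "levels c = {- int (lvl_below c)..int (lvl_above c)}"

definition contracts :: "cyber_model \<Rightarrow> contract set" where
  "contracts c = {No, On} \<union> Off ` {1..horizon c}"

definition mitigations :: "cyber_model \<Rightarrow> nat set" where
  "mitigations c = {0..mitig_max c}"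

text \<open>The canonical space: \<open>W_t\<close> is the coordinate map \<open>\<lambda>\<omega>. \<omega> t\<close>.\<close>

definition prob_law :: "cyber_model \<Rightarrow> scenario measure" where
  "prob_law c = PiM {1..horizon c} (yearly_law c)"

text \<open>For \<open>t = 0\<close> the generator is empty, which gives the trivial \<open>\<sigma>\<close>-algebra.\<close>

definition filt :: "cyber_model \<Rightarrow> nat \<Rightarrow> scenario measure" where
  "filt c t = sigma (space (prob_law c))
     {{\<omega> \<in> space (prob_law c). \<omega> s \<in> A} | s A. s \<in> {1..t} \<and> A \<in> sets loss_space}"

text \<open>
  A distribution function on \<open>[0,\<infinity>)\<close> with finite expectation is given as the \<open>cdf\<close> of
  a probability measure \<open>\<nu>\<close> on the reals which is concentrated on \<open>[0,\<infinity>)\<close> and has a finite mean.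
  The number of incidents need not be integrable, so expected yearly losses can be infinite.
\<close>

locale cyber_provisioning =
  fixes c :: cyber_model
  assumes horizon: "horizon c \<ge> 1"
    and law_prob: "t \<in> {1..horizon c} \<Longrightarrow> prob_space (yearly_law c t)"
    and law_sets: "t \<in> {1..horizon c} \<Longrightarrow> sets (yearly_law c t) = sets loss_space"
    and severities: "t \<in> {1..horizon c} \<Longrightarrow>
      \<exists>\<nu>. real_distribution \<nu> \<and> (AE x in \<nu>. 0 \<le> x) \<and> integrable \<nu> (\<lambda>x. x) \<and>
        (\<forall>n z. (\<forall>k\<in>{1..n}. 0 \<le> z k) \<longrightarrow>
          \<P>(\<omega> in prob_law c. fst (\<omega> t) = n \<and> (\<forall>k\<in>{1..n}. snd (\<omega> t) k \<le> z k)) =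
          \<P>(\<omega> in prob_law c. fst (\<omega> t) = n) * (\<Prod>k=1..n. cdf \<nu> (z k)))"
    and mitig_cost_nonneg: "d \<in> mitigations c \<Longrightarrow> 0 \<le> mitig_cost c d"
    and mitig_effect_nonneg: "d \<in> mitigations c \<Longrightarrow> 0 \<le> mitig_effect c d"
    and mitig_cost_0: "mitig_cost c 0 = 0"
    and mitig_effect_0: "mitig_effect c 0 = 0"
    and BM_level: "b \<in> levels c \<Longrightarrow> 0 \<le> x \<Longrightarrow> BM c b x \<in> levels c"
    and BM_mono: "b \<in> levels c \<Longrightarrow> mono_on {0..} (BM c b)"
    and BM0_state: "b \<in> levels c \<Longrightarrow> i \<in> contracts c \<Longrightarrow> BM0 c b i \<in> levels c \<times> contracts c"
    and BM0_no: "b \<in> levels c \<Longrightarrow> BM0 c b No = (b, No)"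
    and premium_nonneg: "b \<in> levels c \<Longrightarrow> t \<in> {1..horizon c} \<Longrightarrow> 0 \<le> premium c b t"
    and premium_mono: "t \<in> {1..horizon c} \<Longrightarrow> mono_on (levels c) (\<lambda>b. premium c b t)"
    and deductible_nonneg: "b \<in> levels c \<Longrightarrow> t \<in> {1..horizon c} \<Longrightarrow> 0 \<le> deductible c b t"
    and max_comp_nonneg: "b \<in> levels c \<Longrightarrow> t \<in> {1..horizon c} \<Longrightarrow> 0 \<le> max_comp c b t"
    and fee_in_nonneg: "t \<in> {1..horizon c} \<Longrightarrow> 0 \<le> fee_in c t"
    and fee_out_nonneg: "t \<in> {1..horizon c} \<Longrightarrow> 0 \<le> fee_out c t"
    and fee_re_nonneg: "0 \<le> fee_re c"
    and rate_nonneg: "0 \<le> rate c"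

definition mitigated_loss :: "cyber_model \<Rightarrow> nat \<Rightarrow> loss \<Rightarrow> real" where
  "mitigated_loss c d w = (\<Sum>k=1..fst w. max (snd w k - mitig_effect c d) 0)"

definition compensation :: "cyber_model \<Rightarrow> int \<Rightarrow> nat \<Rightarrow> real \<Rightarrow> real" where
  "compensation c b t l = min (max (l - deductible c b t) 0) (max_comp c b t)"


section \<open>The control problem\<close>

text \<open>The decisions \<open>\<iota>, j \<in> {0,1}\<close> are Boolean.\<close>

definition transition ::
    "cyber_model \<Rightarrow> nat \<Rightarrow> int \<Rightarrow> contract \<Rightarrow> nat \<Rightarrow> bool \<Rightarrow> bool \<Rightarrow> loss \<Rightarrow> int \<times> contract" where
  "transition c t b i d \<iota> j w =
     (if \<iota> then (BM c b (of_bool j * compensation c b t (mitigated_loss c d w)), On)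
      else BM0 c b i)"

definition fixed_cost :: "cyber_model \<Rightarrow> nat \<Rightarrow> int \<Rightarrow> contract \<Rightarrow> nat \<Rightarrow> bool \<Rightarrow> real" where
  "fixed_cost c t b i d \<iota> =
     mitig_cost c d + of_bool \<iota> * premium c b t
     + fee_in c t * of_bool (i = No \<and> \<iota>)
     + fee_out c t * of_bool (i = On \<and> \<not> \<iota>)
     + fee_re c * of_bool (i \<noteq> On \<and> i \<noteq> No \<and> \<iota>)"

definition stage_cost ::
    "cyber_model \<Rightarrow> nat \<Rightarrow> int \<Rightarrow> contract \<Rightarrow> nat \<Rightarrow> bool \<Rightarrow> bool \<Rightarrow> loss \<Rightarrow> real" where
  "stage_cost c t b i d \<iota> j w =
     fixed_cost c t b i d \<iota> + mitigated_loss c d w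
     - of_bool \<iota> * of_bool j * compensation c b t (mitigated_loss c d w)"

record policy =
  mitigate :: "nat \<Rightarrow> scenario \<Rightarrow> nat"
  insure :: "nat \<Rightarrow> scenario \<Rightarrow> bool"
  claim :: "nat \<Rightarrow> scenario \<Rightarrow> bool"

definition policies :: "cyber_model \<Rightarrow> policy set" where
  "policies c = {\<pi>. \<forall>t\<in>{1..horizon c}.
     mitigate \<pi> t \<in> filt c (t - 1) \<rightarrow>\<^sub>M count_space (mitigations c) \<and>
     insure \<pi> t \<in> filt c (t - 1) \<rightarrow>\<^sub>M count_space UNIV \<and>
     claim \<pi> t \<in> filt c t \<rightarrow>\<^sub>M count_space UNIV \<and>
     {\<omega> \<in> space (prob_law c). \<not> insure \<pi> t \<omega> \<and> claim \<pi> t \<omega>} = {}}"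

primrec ctrl_state :: "cyber_model \<Rightarrow> policy \<Rightarrow> nat \<Rightarrow> scenario \<Rightarrow> int \<times> contract" where
  "ctrl_state c \<pi> 0 \<omega> = (0, No)"
| "ctrl_state c \<pi> (Suc t) \<omega> =
     transition c (Suc t) (fst (ctrl_state c \<pi> t \<omega>)) (snd (ctrl_state c \<pi> t \<omega>))
       (mitigate \<pi> (Suc t) \<omega>) (insure \<pi> (Suc t) \<omega>) (claim \<pi> (Suc t) \<omega>) (\<omega> (Suc t))"

definition future_cost :: "cyber_model \<Rightarrow> policy \<Rightarrow> nat \<Rightarrow> scenario \<Rightarrow> real" where
  "future_cost c \<pi> t \<omega> =
     (\<Sum>s=t+1..horizon c. exp (- (real (s - t) * rate c)) *
        stage_cost c s (fst (ctrl_state c \<pi> (s - 1) \<omega>)) (snd (ctrl_state c \<pi> (s - 1) \<omega>))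
          (mitigate \<pi> s \<omega>) (insure \<pi> s \<omega>) (claim \<pi> s \<omega>) (\<omega> s))"

text \<open>
  For \<open>\<pi> \<in> policies c\<close> all stage costs are nonnegative, since the compensation never exceeds the
  loss; hence \<open>ennreal\<close> does not truncate, and the conditional expectation is the
  \<open>[0,\<infinity>]\<close>-valued one.  As \<open>filt c 0\<close> is trivial, \<open>policy_value c \<pi> 0\<close> and \<open>optimal_value c\<close> are
  constant on the whole scenario space.
\<close>

definition policy_value :: "cyber_model \<Rightarrow> policy \<Rightarrow> nat \<Rightarrow> scenario \<Rightarrow> ennreal" where
  "policy_value c \<pi> t =
     (if t < horizon c
      then nn_cond_exp (prob_law c) (filt c t) (\<lambda>\<omega>. ennreal (future_cost c \<pi> t \<omega>))
      else (\<lambda>_. 0))"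

definition optimal_value :: "cyber_model \<Rightarrow> scenario \<Rightarrow> ennreal" where
  "optimal_value c \<omega> = (INF \<pi>\<in>policies c. policy_value c \<pi> 0 \<omega>)"


section \<open>The algorithm\<close>

text \<open>
  Throughout, \<open>V t b i\<close> are the values computed by the algorithm, and \<open>dh t b i\<close>,
  \<open>ih t b i\<close> are the minimisers which it selects.
\<close>

definition bm_min :: "cyber_model \<Rightarrow> int \<Rightarrow> int" where
  "bm_min c b = BM c b 0"

definition bm_max :: "cyber_model \<Rightarrow> int \<Rightarrow> int" where
  "bm_max c b = Max (BM c b ` {0..})"

definition claim_threshold ::
    "cyber_model \<Rightarrow> (nat \<Rightarrow> int \<Rightarrow> contract \<Rightarrow> real) \<Rightarrow> nat \<Rightarrow> int \<Rightarrow> int \<Rightarrow> real" where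
  "claim_threshold c V t b b' = V t b' On - V t (bm_min c b) On"

definition claim_region ::
    "cyber_model \<Rightarrow> (nat \<Rightarrow> int \<Rightarrow> contract \<Rightarrow> real) \<Rightarrow> nat \<Rightarrow> int \<Rightarrow> int \<Rightarrow> real set" where
  "claim_region c V t b b' = {x. 0 \<le> x \<and> BM c b x = b' \<and> claim_threshold c V t b b' < x}"

definition alg_H ::
    "cyber_model \<Rightarrow> (nat \<Rightarrow> int \<Rightarrow> contract \<Rightarrow> real) \<Rightarrow> nat \<Rightarrow> int \<Rightarrow> contract \<Rightarrow> nat \<Rightarrow> bool \<Rightarrow> real"
  where
  "alg_H c V t b i d \<iota> =
     (if \<iota> then
        V t (bm_min c b) On
        - (\<Sum>b'=bm_min c b..bm_max c b.
             \<integral>\<omega>. of_bool (BM c b (compensation c b t (mitigated_loss c d (\<omega> t))) = b') *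
                max (compensation c b t (mitigated_loss c d (\<omega> t)) - claim_threshold c V t b b') 0
             \<partial>prob_law c)
      else V t (fst (BM0 c b i)) (snd (BM0 c b i)))"

text \<open>The expected loss may be infinite, so the objective takes values in \<open>(-\<infinity>,\<infinity>]\<close>.\<close>

definition alg_G ::
    "cyber_model \<Rightarrow> (nat \<Rightarrow> int \<Rightarrow> contract \<Rightarrow> real) \<Rightarrow> nat \<Rightarrow> int \<Rightarrow> contract \<Rightarrow> nat \<Rightarrow> bool \<Rightarrow> ereal"
  where
  "alg_G c V t b i d \<iota> =
     ereal (fixed_cost c t b i d \<iota>)
     + enn2ereal (\<integral>\<^sup>+\<omega>. ennreal (mitigated_loss c d (\<omega> t)) \<partial>prob_law c)
     + ereal (alg_H c V t b i d \<iota>)"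

text \<open>
  The minimiser is an arbitrary choice, so the backward induction is a relation between the inputs and
  the computed tables.  Since \<open>V\<close> is real-valued, the last equation also says that the
  minimum is finite.
\<close>

definition alg_run ::
    "cyber_model \<Rightarrow> (nat \<Rightarrow> int \<Rightarrow> contract \<Rightarrow> real) \<Rightarrow> (nat \<Rightarrow> int \<Rightarrow> contract \<Rightarrow> nat) \<Rightarrow>
     (nat \<Rightarrow> int \<Rightarrow> contract \<Rightarrow> bool) \<Rightarrow> bool"
  where
  "alg_run c V dh ih \<longleftrightarrow>
     (\<forall>b\<in>levels c. \<forall>i\<in>contracts c. V (horizon c) b i = 0) \<and>
     (\<forall>t\<in>{1..horizon c}. \<forall>b\<in>levels c. \<forall>i\<in>contracts c.
        dh t b i \<in> mitigations c \<and>
        (\<forall>d\<in>mitigations c. \<forall>\<iota>. alg_G c V t b i (dh t b i) (ih t b i) \<le> alg_G c V t b i d \<iota>) \<and>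
        ereal (V (t - 1) b i) =
          ereal (exp (- rate c)) * Min {alg_G c V t b i d \<iota> | d \<iota>. d \<in> mitigations c})"

definition alg_claim ::
    "cyber_model \<Rightarrow> (nat \<Rightarrow> int \<Rightarrow> contract \<Rightarrow> real) \<Rightarrow> (nat \<Rightarrow> int \<Rightarrow> contract \<Rightarrow> nat) \<Rightarrow>
     (nat \<Rightarrow> int \<Rightarrow> contract \<Rightarrow> bool) \<Rightarrow> nat \<Rightarrow> int \<Rightarrow> contract \<Rightarrow> loss \<Rightarrow> bool"
  where
  "alg_claim c V dh ih t b i w \<longleftrightarrow>
     ih t b i \<and>
     compensation c b t (mitigated_loss c (dh t b i) w)
       \<in> (\<Union>b'\<in>{bm_min c b..bm_max c b}. claim_region c V t b b')"

text \<open>\<open>alg_kernel c V dh ih t (b, i) (b', i')\<close> is the transition probability from \<open>(b, i)\<close> to \<open>(b', i')\<close>.\<close>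

definition alg_kernel ::
    "cyber_model \<Rightarrow> (nat \<Rightarrow> int \<Rightarrow> contract \<Rightarrow> real) \<Rightarrow> (nat \<Rightarrow> int \<Rightarrow> contract \<Rightarrow> nat) \<Rightarrow>
     (nat \<Rightarrow> int \<Rightarrow> contract \<Rightarrow> bool) \<Rightarrow> nat \<Rightarrow> int \<times> contract \<Rightarrow> int \<times> contract \<Rightarrow> real"
  where
  "alg_kernel c V dh ih t = (\<lambda>(b, i) (b', i').
     let up = (\<lambda>b'. \<P>(\<omega> in prob_law c.
            compensation c b t (mitigated_loss c (dh t b i) (\<omega> t)) \<in> claim_region c V t b b'))
     in if ih t b i then
          if i' = On \<and> b' \<in> {bm_min c b<..bm_max c b} then up b'
          else if i' = On \<and> b' = bm_min c b then 1 - (\<Sum>b''\<in>{bm_min c b<..bm_max c b}. up b'')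
          else 0
        else if (b', i') = BM0 c b i then 1 else 0)"

primrec alg_occupancy ::
    "cyber_model \<Rightarrow> (nat \<Rightarrow> int \<Rightarrow> contract \<Rightarrow> real) \<Rightarrow> (nat \<Rightarrow> int \<Rightarrow> contract \<Rightarrow> nat) \<Rightarrow>
     (nat \<Rightarrow> int \<Rightarrow> contract \<Rightarrow> bool) \<Rightarrow> nat \<Rightarrow> int \<times> contract \<Rightarrow> real"
  where
  "alg_occupancy c V dh ih 0 x = (if x = (0, No) then 1 else 0)"
| "alg_occupancy c V dh ih (Suc t) x =
     (\<Sum>y\<in>levels c \<times> contracts c. alg_kernel c V dh ih (Suc t) y x * alg_occupancy c V dh ih t y)"

definition alg_zeta ::
    "cyber_model \<Rightarrow> (nat \<Rightarrow> int \<Rightarrow> contract \<Rightarrow> real) \<Rightarrow> (nat \<Rightarrow> int \<Rightarrow> contract \<Rightarrow> nat) \<Rightarrow>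
     (nat \<Rightarrow> int \<Rightarrow> contract \<Rightarrow> bool) \<Rightarrow> (nat \<Rightarrow> int \<Rightarrow> contract \<Rightarrow> loss \<Rightarrow> real) \<Rightarrow> nat \<Rightarrow> real"
  where
  "alg_zeta c V dh ih \<zeta> t =
     (\<Sum>(b, i)\<in>levels c \<times> contracts c.
        (\<integral>\<omega>. \<zeta> t b i (\<omega> t) \<partial>prob_law c) * alg_occupancy c V dh ih (t - 1) (b, i))"

definition alg_zeta_total ::
    "cyber_model \<Rightarrow> (nat \<Rightarrow> int \<Rightarrow> contract \<Rightarrow> real) \<Rightarrow> (nat \<Rightarrow> int \<Rightarrow> contract \<Rightarrow> nat) \<Rightarrow>
     (nat \<Rightarrow> int \<Rightarrow> contract \<Rightarrow> bool) \<Rightarrow> (nat \<Rightarrow> int \<Rightarrow> contract \<Rightarrow> loss \<Rightarrow> real) \<Rightarrow> real"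
  where
  "alg_zeta_total c V dh ih \<zeta> = (\<Sum>t=1..horizon c. alg_zeta c V dh ih \<zeta> t)"

text \<open>
  The policy of the algorithm and its controlled process are defined by a joint recursion.  Here the process
  \<open>alg_state\<close> is obtained first; \<open>alg_state_eq\<close> shows that it is the process controlled
  by \<open>alg_policy\<close>.
\<close>

primrec alg_state ::
    "cyber_model \<Rightarrow> (nat \<Rightarrow> int \<Rightarrow> contract \<Rightarrow> real) \<Rightarrow> (nat \<Rightarrow> int \<Rightarrow> contract \<Rightarrow> nat) \<Rightarrow>
     (nat \<Rightarrow> int \<Rightarrow> contract \<Rightarrow> bool) \<Rightarrow> nat \<Rightarrow> scenario \<Rightarrow> int \<times> contract"
  where
  "alg_state c V dh ih 0 \<omega> = (0, No)"
| "alg_state c V dh ih (Suc t) \<omega> =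
     (let (b, i) = alg_state c V dh ih t \<omega>
      in transition c (Suc t) b i (dh (Suc t) b i) (ih (Suc t) b i)
           (alg_claim c V dh ih (Suc t) b i (\<omega> (Suc t))) (\<omega> (Suc t)))"

definition alg_policy ::
    "cyber_model \<Rightarrow> (nat \<Rightarrow> int \<Rightarrow> contract \<Rightarrow> real) \<Rightarrow> (nat \<Rightarrow> int \<Rightarrow> contract \<Rightarrow> nat) \<Rightarrow>
     (nat \<Rightarrow> int \<Rightarrow> contract \<Rightarrow> bool) \<Rightarrow> policy"
  where
  "alg_policy c V dh ih =
     \<lparr>mitigate = (\<lambda>t \<omega>. case alg_state c V dh ih (t - 1) \<omega> of (b, i) \<Rightarrow> dh t b i),
      insure = (\<lambda>t \<omega>. case alg_state c V dh ih (t - 1) \<omega> of (b, i) \<Rightarrow> ih t b i),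
      claim = (\<lambda>t \<omega>. case alg_state c V dh ih (t - 1) \<omega> of (b, i) \<Rightarrow>
                        alg_claim c V dh ih t b i (\<omega> t))\<rparr>"

lemma alg_state_eq: "ctrl_state c (alg_policy c V dh ih) t \<omega> = alg_state c V dh ih t \<omega>"
  by (induction t) (simp_all add: alg_policy_def split_beta Let_def)

end

theory Submission
  imports Defs
begin

text \<open>
  The algorithm is backward induction for a finite-horizon Markov decision problem, and the proof is
  a verification argument.  One feature is particular to the model: the claim decision of year \<open>t\<close> is
  taken after the loss of that year has been seen, whereas mitigation and insurance are chosen before.
  The minimum over the claim decision therefore stands inside the expectation.  For an insured agent
  with compensation \<open>x\<close> this minimum is
  \<open>min (V\<^sub>t(b_min, On)) (V\<^sub>t(BM b x, On) - x) = V\<^sub>t(b_min, On) - (x - \<alpha>\<^sub>t(b, BM b x))\<^sup>+\<close>,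
  where \<open>b_min\<close> is the level reached without a claim.  Splitting the right-hand side according to the
  value of \<open>BM b x\<close> gives the sum in \<open>alg_H\<close>.  Hence \<open>alg_G\<close> is the expectation of the pointwise minimal
  cost \<open>best_cost\<close> (\<open>expected_best_cost\<close>), and the tables of the algorithm satisfy the Bellman equation
  (\<open>bellman_eq\<close>, \<open>bellman_le\<close>).

  Optimality.  For an admissible policy the state at the beginning of year \<open>t\<close> and the mitigation and
  insurance decisions for that year take finitely many values and are determined by the losses of the
  earlier years, so they are independent of the loss of year \<open>t\<close>; inside an
  expectation they may be frozen while the new loss is averaged (\<open>freezing\<close>).  With the Bellman
  inequality this gives
  \<open>E[V\<^sub>t(state\<^sub>t)] \<le> e\<^sup>-\<^sup>r E[cost\<^sub>t\<^sub>+\<^sub>1 + V\<^sub>t\<^sub>+\<^sub>1(state\<^sub>t\<^sub>+\<^sub>1)]\<close>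
  for every policy, with equality for the policy of the algorithm, whose claim rule selects the pointwise
  minimum.  Backward induction from \<open>V\<^sub>T = 0\<close> turns this into \<open>V\<^sub>0(0, No) \<le> E[total cost]\<close>, again with
  equality for the policy of the algorithm.  All costs are nonnegative, so the expectations are taken in
  \<open>[0,\<infinity>]\<close> and policies with infinite expected cost need no separate treatment.  The value at time \<open>0\<close> is a
  conditional expectation given the trivial \<open>\<sigma>\<close>-algebra, i.e. this expectation (\<open>policy_value_0\<close>).

  Kernels, occupancies and quantities of interest.  Under the policy of the algorithm the next state is
  a fixed function \<open>move\<close> of the current state and the new loss.  By the same independence the states form
  a Markov chain whose transition probabilities are the laws of \<open>move\<close>, and these are the numbers stored
  in \<open>alg_kernel\<close>: a level above \<open>b_min\<close> is reached exactly when the compensation lies in its claim region,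
  and \<open>b_min\<close> receives the remaining mass.
\<close>

section \<open>Measurability of losses\<close>

abbreviation severities_space :: "nat \<Rightarrow> (nat \<Rightarrow> real) measure" where
  "severities_space n \<equiv> PiM {1..n} (\<lambda>_. restrict_space borel {0..})"

lemma space_severities_space: "space (severities_space n) = {1..n} \<rightarrow>\<^sub>E {0..}"
  by (simp add: space_PiM space_restrict_space)

lemma loss_space_generator:
  "{{n} \<times> A | n A. A \<in> sets (severities_space n)} \<subseteq> Pow loss_set"
  using sets.sets_into_space[of _ "severities_space _"]
  unfolding space_severities_space loss_set_def by fastforce

lemma space_loss_space: "space loss_space = loss_set"
  unfolding loss_space_def using loss_space_generator by (rule space_measure_of)

lemma sets_loss_space:
  "sets loss_space = sigma_sets loss_set {{n} \<times> A | n A. A \<in> sets (severities_space n)}"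
  unfolding loss_space_def using loss_space_generator by (rule sets_measure_of)

text \<open>
  The space of losses is a countable disjoint union of product spaces, so measurability can be checked
  for each number of incidents separately.
\<close>

lemma measurable_from_loss_space:
  assumes sections: "\<And>n. (\<lambda>x. f (n, x)) \<in> severities_space n \<rightarrow>\<^sub>M N"
  shows "f \<in> loss_space \<rightarrow>\<^sub>M N"
proof (rule measurableI)
  fix w assume "w \<in> space loss_space"
  then show "f w \<in> space N"
    using measurable_space[OF sections, of "snd w" "fst w"] space_severities_space
    by (auto simp: space_loss_space loss_set_def)
next
  fix B assume B: "B \<in> sets N"
  have eq: "f -` B \<inter> space loss_space =
      (\<Union>n. {n} \<times> ((\<lambda>x. f (n, x)) -` B \<inter> space (severities_space n)))"
    unfolding space_loss_space loss_set_def space_severities_space by auto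
  show "f -` B \<inter> space loss_space \<in> sets loss_space"
    unfolding eq
  proof (rule sets.countable_UN'')
    fix n
    have "(\<lambda>x. f (n, x)) -` B \<inter> space (severities_space n) \<in> sets (severities_space n)"
      using sections B by (rule measurable_sets)
    then show "{n} \<times> ((\<lambda>x. f (n, x)) -` B \<inter> space (severities_space n)) \<in> sets loss_space"
      unfolding sets_loss_space by (intro sigma_sets.Basic) auto
  qed simp
qed

lemma measurable_mitigated_loss [measurable]:
  "mitigated_loss c d \<in> borel_measurable loss_space"
proof (rule measurable_from_loss_space)
  fix n :: nat
  have "(\<lambda>x. x k) \<in> borel_measurable (severities_space n)"
    if "k \<in> {1..n}" for k :: nat
    using measurable_component_singleton[OF that, of "\<lambda>_. restrict_space borel {0..} :: real measure"]
    by (simp add: measurable_restrict_space2_iff)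
  then show "(\<lambda>x. mitigated_loss c d (n, x))
      \<in> borel_measurable (severities_space n)"
    unfolding mitigated_loss_def fst_conv snd_conv
    by (intro borel_measurable_sum borel_measurable_max borel_measurable_diff) auto
qed

lemma measurable_compensation [measurable]: "compensation c b t \<in> borel_measurable borel"
  unfolding compensation_def[abs_def] by measurable

lemma mitigated_loss_nonneg: "0 \<le> mitigated_loss c d w"
  unfolding mitigated_loss_def by (intro sum_nonneg) simp

lemma finite_levels: "finite (levels c)"
  by (simp add: levels_def)

lemma finite_contracts: "finite (contracts c)"
  by (simp add: contracts_def)

lemma finite_mitigations: "finite (mitigations c)"
  by (simp add: mitigations_def)

section \<open>States and the information available in each year\<close>

abbreviation (input) states :: "cyber_model \<Rightarrow> (int \<times> contract) set" where
  "states c \<equiv> levels c \<times> contracts c"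

lemma finite_states: "finite (states c)"
  by (simp add: finite_levels finite_contracts)

lemma initial_state: "(0, No) \<in> states c"
  by (simp add: levels_def contracts_def)

lemma On_contract: "On \<in> contracts c"
  by (simp add: contracts_def)

lemma filt_generator: 
  "{{\<omega> \<in> space (prob_law c). \<omega> s \<in> A} | s A. s \<in> {1..t} \<and> A \<in> sets loss_space}
     \<subseteq> Pow (space (prob_law c))"
  by auto

lemma space_filt [simp]: "space (filt c t) = space (prob_law c)"
  unfolding filt_def by (rule space_measure_of[OF filt_generator])

lemma sets_filt:
  "sets (filt c t) = sigma_sets (space (prob_law c))
     {{\<omega> \<in> space (prob_law c). \<omega> s \<in> A} | s A. s \<in> {1..t} \<and> A \<in> sets loss_space}"
  unfolding filt_def by (rule sets_measure_of[OF filt_generator])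

lemma sets_filt_mono: "s \<le> t \<Longrightarrow> sets (filt c s) \<subseteq> sets (filt c t)"
  unfolding sets_filt by (rule sigma_sets_mono') fastforce

lemma filt_mono: "s \<le> t \<Longrightarrow> f \<in> filt c s \<rightarrow>\<^sub>M N \<Longrightarrow> f \<in> filt c t \<rightarrow>\<^sub>M N"
  using sets_filt_mono[of s t c] unfolding measurable_def by auto

lemma sets_filt_0: "sets (filt c 0) = {{}, space (prob_law c)}"
proof -
  have "{{\<omega> \<in> space (prob_law c). \<omega> s \<in> A} | s A. s \<in> {1..0::nat} \<and> A \<in> sets loss_space} = {}"
    by simp
  then show ?thesis
    unfolding sets_filt by (simp add: sigma_sets_empty_eq)
qed

text \<open>
  Conditional expectations are only determined almost everywhere, but one given a trivial \<open>\<sigma>\<close>-algebra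
  is constant.  This is why the value at time \<open>0\<close> is known at every single scenario.
\<close>

lemma filt_0_constant:
  fixes f :: "scenario \<Rightarrow> ennreal"
  assumes f: "f \<in> borel_measurable (filt c 0)" and \<omega>: "\<omega> \<in> space (prob_law c)" "\<omega>' \<in> space (prob_law c)"
  shows "f \<omega> = f \<omega>'"
proof -
  have "f -` {f \<omega>} \<inter> space (filt c 0) \<in> sets (filt c 0)"
    using f by (rule measurable_sets) simp
  then have "f -` {f \<omega>} \<inter> space (prob_law c) = space (prob_law c)"
    using \<omega> by (auto simp: sets_filt_0)
  then have "\<omega>' \<in> f -` {f \<omega>} \<inter> space (prob_law c)" using \<omega> by simp
  then show ?thesis by simp
qed

context cyber_provisioning
begin

lemma space_yearly_law: "t \<in> {1..horizon c} \<Longrightarrow> space (yearly_law c t) = space loss_space"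
  using law_sets by (rule sets_eq_imp_space_eq)

lemma coordinate_in_loss_space:
  "t \<in> {1..horizon c} \<Longrightarrow> \<omega> \<in> space (prob_law c) \<Longrightarrow> \<omega> t \<in> space loss_space"
  unfolding prob_law_def space_PiM using space_yearly_law by (auto dest: PiE_mem)

lemma prob_space_prob_law: "prob_space (prob_law c)"
  unfolding prob_law_def by (rule prob_space_PiM) (rule law_prob)

sublocale P: prob_space "prob_law c"
  by (rule prob_space_prob_law)

lemma measurable_coordinate: "t \<in> {1..horizon c} \<Longrightarrow> (\<lambda>\<omega>. \<omega> t) \<in> prob_law c \<rightarrow>\<^sub>M loss_space"
  using measurable_component_singleton[of t "{1..horizon c}" "yearly_law c"]
    measurable_cong_sets[OF refl law_sets]
  unfolding prob_law_def by blast

lemma measurable_coordinate_filt: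
  assumes "s \<in> {1..t}" "t \<le> horizon c"
  shows "(\<lambda>\<omega>. \<omega> s) \<in> filt c t \<rightarrow>\<^sub>M loss_space"
proof (rule measurableI)
  show "\<omega> s \<in> space loss_space" if "\<omega> \<in> space (filt c t)" for \<omega>
    using that assms coordinate_in_loss_space by simp
  show "(\<lambda>\<omega>. \<omega> s) -` A \<inter> space (filt c t) \<in> sets (filt c t)" if "A \<in> sets loss_space" for A
    unfolding sets_filt space_filt using that assms(1)
    by (intro sigma_sets.Basic) (auto simp: vimage_def Int_def)
qed

lemma sets_filt_subset: 
  assumes "t \<le> horizon c"
  shows "sets (filt c t) \<subseteq> sets (prob_law c)"
  unfolding sets_filt
proof (rule sets.sigma_sets_subset, safe)
  fix s A assume "s \<in> {1..t}" "A \<in> sets loss_space"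
  then show "{\<omega> \<in> space (prob_law c). \<omega> s \<in> A} \<in> sets (prob_law c)"
    using measurable_sets[OF measurable_coordinate, of s A] assms
    by (simp add: vimage_def Int_def conj_commute)
qed


lemma past_event_measurable:
  assumes "A \<in> sets (filt c (t - 1))" and "t \<in> {1..horizon c}"
  shows "A \<in> sets (prob_law c)"
proof -
  have "t - 1 \<le> horizon c" using assms(2) by auto
  then show ?thesis using assms(1) sets_filt_subset by blast
qed

lemma filt_measurable: "t \<le> horizon c \<Longrightarrow> f \<in> filt c t \<rightarrow>\<^sub>M N \<Longrightarrow> f \<in> prob_law c \<rightarrow>\<^sub>M N"
  using sets_filt_subset[of t] unfolding measurable_def by auto

text \<open>
  An event that belongs to the past of year \<open>t\<close> does not look at the coordinate \<open>t\<close>.  In this form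
  independence of the past and the new loss needs nothing beyond Fubini's theorem.
\<close>

lemma past_event_update:
  assumes A: "A \<in> sets (filt c (t - 1))" and t: "t \<in> {1..horizon c}"
    and y: "y \<in> space loss_space" and \<omega>: "\<omega> \<in> space (prob_law c)"
  shows "(fun_upd \<omega> t y) \<in> A \<longleftrightarrow> \<omega> \<in> A"
proof -
  have upd: "(fun_upd \<omega> t y) \<in> space (prob_law c)" if "\<omega> \<in> space (prob_law c)" for \<omega>
    using that y t unfolding prob_law_def space_PiM
    by (auto simp: PiE_iff space_yearly_law extensional_def)
  from A have "\<forall>\<omega>\<in>space (prob_law c). (fun_upd \<omega> t y) \<in> A \<longleftrightarrow> \<omega> \<in> A"
    unfolding sets_filt
  proof induction
    case (Basic A)
    then obtain s B where "s \<in> {1..t - 1}" "A = {\<omega> \<in> space (prob_law c). \<omega> s \<in> B}"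
      by blast
    moreover from this have "s \<noteq> t" using t by auto
    ultimately show ?case using upd by (simp del: fun_upd_apply add: fun_upd_other)
  next
    case Empty
    then show ?case by simp
  next
    case (Compl A)
    show ?case
    proof
      fix \<omega> assume "\<omega> \<in> space (prob_law c)"
      then show "fun_upd \<omega> t y \<in> space (prob_law c) - A \<longleftrightarrow> \<omega> \<in> space (prob_law c) - A"
        using upd[of \<omega>] Compl.IH by blast
    qed
  next
    case (Union A)
    then show ?case by blast
  qed
  then show ?thesis using \<omega> by blast
qed

section \<open>Independence of the past and the new loss\<close>

text \<open>
  Integrating over the coordinate \<open>t\<close> first, the indicator of a past event is a constant factor.
\<close>

lemma nn_integral_past_times_loss:
  fixes h :: "loss \<Rightarrow> ennreal"
  assumes A: "A \<in> sets (filt c (t - 1))" and t: "t \<in> {1..horizon c}"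
    and h: "h \<in> borel_measurable loss_space"
  shows "(\<integral>\<^sup>+\<omega>. indicator A \<omega> * h (\<omega> t) \<partial>prob_law c)
    = emeasure (prob_law c) A * (\<integral>\<^sup>+\<omega>. h (\<omega> t) \<partial>prob_law c)"
proof -
  let ?I = "{1..horizon c} - {t}"
  \<comment> \<open>The family of laws is only known to consist of probability measures inside the horizon; the
      product locale needs this for every index.\<close>
  define law where "law s = (if s \<in> {1..horizon c} then yearly_law c s else yearly_law c t)" for s
  have law: "prob_space (law s)" "sets (law s) = sets loss_space" for s
    using t law_prob law_sets by (auto simp: law_def)
  have space_law: "space (law s) = space loss_space" for s
    using law(2) by (rule sets_eq_imp_space_eq)
  interpret product_sigma_finite law
    unfolding product_sigma_finite_def by (intro allI prob_space_imp_sigma_finite law)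
  have I: "insert t ?I = {1..horizon c}" using t by auto
  have PL: "prob_law c = PiM (insert t ?I) law"
    unfolding prob_law_def I by (intro PiM_cong) (auto simp: law_def)
  \<comment> \<open>A past event may be evaluated with any fixed loss \<open>y0\<close> at the coordinate \<open>t\<close>.\<close>
  obtain y0 where y0: "y0 \<in> space loss_space"
    using P.not_empty coordinate_in_loss_space[OF t] by blast
  have split: "(\<integral>\<^sup>+\<omega>. indicator B \<omega> * g (\<omega> t) \<partial>prob_law c) =
      (\<integral>\<^sup>+x. indicator B (x(t := y0)) \<partial>PiM ?I law) * (\<integral>\<^sup>+y. g y \<partial>law t)"
    if B: "B \<in> sets (filt c (t - 1))" and g: "g \<in> borel_measurable loss_space"
    for B and g :: "loss \<Rightarrow> ennreal"
  proof -
    have B': "B \<in> sets (prob_law c)"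
      using past_event_measurable[OF B t] .
    have g': "g \<in> borel_measurable (law t)"
      using g by (simp add: measurable_cong_sets[OF law(2) refl])
    have meas: "(\<lambda>\<omega>. indicator B \<omega> * g (\<omega> t)) \<in> borel_measurable (PiM (insert t ?I) law)"
      using measurable_compose[OF measurable_coordinate[OF t] g] B'
      unfolding PL by measurable
    have "(\<integral>\<^sup>+\<omega>. indicator B \<omega> * g (\<omega> t) \<partial>prob_law c) =
        (\<integral>\<^sup>+x. \<integral>\<^sup>+y. indicator B (x(t := y)) * g y \<partial>law t \<partial>PiM ?I law)"
      unfolding PL using product_nn_integral_insert[OF _ _ meas] by simp
    also have "\<dots> = (\<integral>\<^sup>+x. \<integral>\<^sup>+y. indicator B (x(t := y0)) * g y \<partial>law t \<partial>PiM ?I law)"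
    proof (intro nn_integral_cong)
      fix x y assume x: "x \<in> space (PiM ?I law)" and y: "y \<in> space (law t)"
      have "x(t := y0) \<in> space (prob_law c)"
        using x y0 t unfolding PL space_PiM
        by (auto simp: PiE_iff space_law extensional_def)
      from past_event_update[OF B t _ this, of y] y
      show "indicator B (x(t := y)) * g y = indicator B (x(t := y0)) * g y"
        by (simp add: space_law indicator_def)
    qed
    also have "\<dots> = (\<integral>\<^sup>+x. indicator B (x(t := y0)) * (\<integral>\<^sup>+y. g y \<partial>law t) \<partial>PiM ?I law)"
      using g' by (simp add: nn_integral_cmult)
    also have "\<dots> = (\<integral>\<^sup>+x. indicator B (x(t := y0)) \<partial>PiM ?I law) * (\<integral>\<^sup>+y. g y \<partial>law t)"
    proof (rule nn_integral_multc)
      have "(\<lambda>x. x(t := y0)) \<in> PiM ?I law \<rightarrow>\<^sub>M prob_law c"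
        unfolding PL using y0 measurable_fun_upd[of "insert t ?I" ?I t "\<lambda>x. x" "PiM ?I law" law "\<lambda>_. y0"]
        by (simp add: space_law)
      then show "(\<lambda>x. indicator B (x(t := y0)) :: ennreal) \<in> borel_measurable (PiM ?I law)"
        using B' by measurable
    qed
    finally show ?thesis .
  qed
  have total: "emeasure (law t) (space (law t)) = 1"
    using law(1) by (rule prob_space.emeasure_space_1)
  have A': "A \<in> sets (prob_law c)"
    using past_event_measurable[OF A t] .
  have \<Omega>: "space (prob_law c) \<in> sets (filt c (t - 1))"
    using sets.top[of "filt c (t - 1)"] by simp
  have prob_A: "emeasure (prob_law c) A = (\<integral>\<^sup>+x. indicator A (x(t := y0)) \<partial>PiM ?I law)"
    using split[OF A, of "\<lambda>_. 1"] total A' by simp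
  have one: "(\<integral>\<^sup>+x. indicator (space (prob_law c)) (x(t := y0)) \<partial>PiM ?I law) = (1::ennreal)"
    using split[OF \<Omega>, of "\<lambda>_. 1"] total P.emeasure_space_1 by simp
  have "(\<integral>\<^sup>+\<omega>. h (\<omega> t) \<partial>prob_law c) =
      (\<integral>\<^sup>+\<omega>. indicator (space (prob_law c)) \<omega> * h (\<omega> t) \<partial>prob_law c)"
    by (intro nn_integral_cong) simp
  also have "\<dots> = (\<integral>\<^sup>+y. h y \<partial>law t)"
    unfolding split[OF \<Omega> h] one by simp
  finally show ?thesis
    unfolding split[OF A h] prob_A by simp
qed

lemma integral_past_times_loss:
  fixes h :: "loss \<Rightarrow> real"
  assumes A: "A \<in> sets (filt c (t - 1))" and t: "t \<in> {1..horizon c}"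
    and h: "h \<in> borel_measurable loss_space"
    and int: "integrable (prob_law c) (\<lambda>\<omega>. h (\<omega> t))"
  shows "integrable (prob_law c) (\<lambda>\<omega>. indicator A \<omega> * h (\<omega> t))"
    and "(\<integral>\<omega>. indicator A \<omega> * h (\<omega> t) \<partial>prob_law c)
      = measure (prob_law c) A * (\<integral>\<omega>. h (\<omega> t) \<partial>prob_law c)"
proof -
  have A': "A \<in> sets (prob_law c)"
    using past_event_measurable[OF A t] .
  show int': "integrable (prob_law c) (\<lambda>\<omega>. indicator A \<omega> * h (\<omega> t))"
    using integrable_mult_indicator[OF A' int] by simp
  have "ennreal (indicator A \<omega> * x) = indicator A \<omega> * ennreal x"
    "ennreal (- (indicator A \<omega> * x)) = indicator A \<omega> * ennreal (- x)" for \<omega> and x :: real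
    by (simp_all add: indicator_def)
  then show "(\<integral>\<omega>. indicator A \<omega> * h (\<omega> t) \<partial>prob_law c)
      = measure (prob_law c) A * (\<integral>\<omega>. h (\<omega> t) \<partial>prob_law c)"
    unfolding real_lebesgue_integral_def[OF int'] real_lebesgue_integral_def[OF int]
    using nn_integral_past_times_loss[OF A t, of "\<lambda>w. ennreal (h w)"]
      nn_integral_past_times_loss[OF A t, of "\<lambda>w. ennreal (- h w)"] h
    by (simp add: enn2real_mult measure_def right_diff_distrib)
qed

lemma prob_past_and_loss:
  assumes A: "A \<in> sets (filt c (t - 1))" and t: "t \<in> {1..horizon c}"
    and B: "{w \<in> space loss_space. B w} \<in> sets loss_space"
  shows "\<P>(\<omega> in prob_law c. \<omega> \<in> A \<and> B (\<omega> t)) = measure (prob_law c) A * \<P>(\<omega> in prob_law c. B (\<omega> t))"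
proof -
  let ?B = "{w \<in> space loss_space. B w}"
  have A': "A \<in> sets (prob_law c)"
    using past_event_measurable[OF A t] .
  have B': "{\<omega> \<in> space (prob_law c). B (\<omega> t)} \<in> sets (prob_law c)"
  proof -
    have "{\<omega> \<in> space (prob_law c). B (\<omega> t)} = (\<lambda>\<omega>. \<omega> t) -` ?B \<inter> space (prob_law c)"
      using coordinate_in_loss_space[OF t] by auto
    then show ?thesis using measurable_sets[OF measurable_coordinate[OF t] B] by simp
  qed
  have eq: "(\<integral>\<^sup>+\<omega>. indicator ?B (\<omega> t) \<partial>prob_law c) = emeasure (prob_law c) {\<omega> \<in> space (prob_law c). B (\<omega> t)}"
    unfolding nn_integral_indicator[OF B', symmetric]
    by (intro nn_integral_cong) (auto simp: indicator_def coordinate_in_loss_space[OF t])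
  have "emeasure (prob_law c) {\<omega> \<in> space (prob_law c). \<omega> \<in> A \<and> B (\<omega> t)}
      = emeasure (prob_law c) (A \<inter> {\<omega> \<in> space (prob_law c). B (\<omega> t)})"
    by (rule arg_cong[where f="emeasure _"]) auto
  also have "\<dots> = (\<integral>\<^sup>+\<omega>. indicator (A \<inter> {\<omega> \<in> space (prob_law c). B (\<omega> t)}) \<omega> \<partial>prob_law c)"
    using A' B' by (subst nn_integral_indicator) auto
  also have "\<dots> = (\<integral>\<^sup>+\<omega>. indicator A \<omega> * indicator ?B (\<omega> t) \<partial>prob_law c)"
    by (intro nn_integral_cong) (auto simp: indicator_def coordinate_in_loss_space[OF t])
  also have "\<dots> = emeasure (prob_law c) A * emeasure (prob_law c) {\<omega> \<in> space (prob_law c). B (\<omega> t)}"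
    using nn_integral_past_times_loss[OF A t, of "indicator ?B"] B unfolding eq by simp
  finally show ?thesis by (simp add: measure_def enn2real_mult)
qed

text \<open>
  Past-determined quantities can be treated as constants while the new loss is averaged.  This is the
  substitute for conditioning on the past: as \<open>Y\<close> takes finitely many values, the integrand is a finite
  sum of products of a past event with a function of the new loss.
\<close>

lemma freezing:
  fixes h :: "'k \<Rightarrow> loss \<Rightarrow> ennreal"
  assumes Y: "Y \<in> filt c (t - 1) \<rightarrow>\<^sub>M count_space K" and K: "finite K"
    and t: "t \<in> {1..horizon c}"
    and h: "\<And>k. k \<in> K \<Longrightarrow> h k \<in> borel_measurable loss_space"
  shows "(\<integral>\<^sup>+\<omega>. h (Y \<omega>) (\<omega> t) \<partial>prob_law c)
    = (\<integral>\<^sup>+\<omega>. (\<integral>\<^sup>+\<omega>'. h (Y \<omega>) (\<omega>' t) \<partial>prob_law c) \<partial>prob_law c)"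
proof -
  define A where "A k = Y -` {k} \<inter> space (prob_law c)" for k
  have A: "A k \<in> sets (filt c (t - 1))" if "k \<in> K" for k
    using measurable_sets[OF Y, of "{k}"] that unfolding A_def by simp
  have A': "A k \<in> sets (prob_law c)" if "k \<in> K" for k
    using past_event_measurable[OF A[OF that] t] .
  have YK: "Y \<omega> \<in> K" if "\<omega> \<in> space (prob_law c)" for \<omega>
    using measurable_space[OF Y, of \<omega>] that by simp
  have pick: "g (Y \<omega>) = (\<Sum>k\<in>K. indicator (A k) \<omega> * g k)"
    if "\<omega> \<in> space (prob_law c)" for \<omega> and g :: "'k \<Rightarrow> ennreal"
  proof -
    have "(\<Sum>k\<in>K. indicator (A k) \<omega> * g k) = (\<Sum>k\<in>K. if k = Y \<omega> then g k else 0)"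
      using that by (intro sum.cong) (auto simp: A_def indicator_def)
    then show ?thesis using K YK[OF that] by simp
  qed
  have coord: "(\<lambda>\<omega>. h k (\<omega> t)) \<in> borel_measurable (prob_law c)" if "k \<in> K" for k
    using measurable_compose[OF measurable_coordinate[OF t] h[OF that]] .
  have "(\<integral>\<^sup>+\<omega>. h (Y \<omega>) (\<omega> t) \<partial>prob_law c) =
      (\<integral>\<^sup>+\<omega>. (\<Sum>k\<in>K. indicator (A k) \<omega> * h k (\<omega> t)) \<partial>prob_law c)"
    by (intro nn_integral_cong) (rule pick)
  also have "\<dots> = (\<Sum>k\<in>K. \<integral>\<^sup>+\<omega>. indicator (A k) \<omega> * h k (\<omega> t) \<partial>prob_law c)"
    using A' coord by (intro nn_integral_sum) auto
  also have "\<dots> = (\<Sum>k\<in>K. \<integral>\<^sup>+\<omega>. indicator (A k) \<omega> * (\<integral>\<^sup>+\<omega>'. h k (\<omega>' t) \<partial>prob_law c) \<partial>prob_law c)"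
    using A A' h nn_integral_past_times_loss[OF _ t]
    by (intro sum.cong) (auto simp: nn_integral_multc)
  also have "\<dots> = (\<integral>\<^sup>+\<omega>. (\<Sum>k\<in>K. indicator (A k) \<omega> * (\<integral>\<^sup>+\<omega>'. h k (\<omega>' t) \<partial>prob_law c)) \<partial>prob_law c)"
    using A' by (intro nn_integral_sum[symmetric]) auto
  also have "\<dots> = (\<integral>\<^sup>+\<omega>. (\<integral>\<^sup>+\<omega>'. h (Y \<omega>) (\<omega>' t) \<partial>prob_law c) \<partial>prob_law c)"
    by (intro nn_integral_cong) (rule pick[symmetric])
  finally show ?thesis .
qed

section \<open>The controlled process\<close>

lemma compensation_bounds:
  assumes "b \<in> levels c" "t \<in> {1..horizon c}" "0 \<le> l"
  shows "0 \<le> compensation c b t l" "compensation c b t l \<le> l"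
    "compensation c b t l \<le> max_comp c b t"
  using deductible_nonneg[OF assms(1,2)] max_comp_nonneg[OF assms(1,2)] assms(3)
  unfolding compensation_def by auto

lemma fixed_cost_nonneg:
  assumes "b \<in> levels c" "t \<in> {1..horizon c}" "d \<in> mitigations c"
  shows "0 \<le> fixed_cost c t b i d \<iota>"
  using mitig_cost_nonneg[OF assms(3)] premium_nonneg[OF assms(1,2)] fee_in_nonneg[OF assms(2)]
    fee_out_nonneg[OF assms(2)] fee_re_nonneg
  unfolding fixed_cost_def by simp

lemma stage_cost_nonneg:
  assumes "b \<in> levels c" "t \<in> {1..horizon c}" "d \<in> mitigations c"
  shows "0 \<le> stage_cost c t b i d \<iota> j w"
  using fixed_cost_nonneg[OF assms, of i \<iota>] mitigated_loss_nonneg[of c d w]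
    compensation_bounds(2)[OF assms(1,2) mitigated_loss_nonneg, of c d w]
  unfolding stage_cost_def by (cases \<iota>; cases j) auto

lemma transition_state:
  assumes "b \<in> levels c" "i \<in> contracts c" "t \<in> {1..horizon c}"
  shows "transition c t b i d \<iota> j w \<in> states c"
  using assms BM0_state[OF assms(1,2)] compensation_bounds(1)[OF assms(1,3) mitigated_loss_nonneg, of c d w]
  by (cases \<iota>; cases j) (auto simp: transition_def On_contract intro!: BM_level)

text \<open>
  A monotone function on \<open>[0,\<infinity>)\<close> is Borel.  Extending it to the left by its value at \<open>0\<close> makes it monotone
  on the whole line.
\<close>

lemma measurable_BM:
  assumes b: "b \<in> levels c" and f [measurable]: "f \<in> borel_measurable M"
    and pos: "\<And>x. x \<in> space M \<Longrightarrow> 0 \<le> f x"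
  shows "(\<lambda>x. BM c b (f x)) \<in> M \<rightarrow>\<^sub>M count_space UNIV"
proof -
  let ?g = "\<lambda>x. real_of_int (BM c b (max x 0))"
  have "mono ?g"
    using BM_mono[OF b] by (intro monoI) (auto simp: monotone_on_def max_def)
  then have [measurable]: "?g \<in> borel_measurable borel"
    by (rule borel_measurable_mono)
  have "(\<lambda>x. \<lfloor>?g (f x)\<rfloor>) \<in> M \<rightarrow>\<^sub>M count_space UNIV"
    by measurable
  then show ?thesis
    by (rule measurable_cong[THEN iffD1, rotated]) (simp add: pos max_absorb1)
qed

lemma measurable_transition:
  assumes b: "b \<in> levels c" and i: "i \<in> contracts c" and t: "t \<in> {1..horizon c}"
  shows "transition c t b i d \<iota> j \<in> loss_space \<rightarrow>\<^sub>M count_space (states c)"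
proof -
  have pos: "0 \<le> of_bool j * compensation c b t (mitigated_loss c d w)" for w
    using compensation_bounds(1)[OF b t mitigated_loss_nonneg] by simp
  have "(\<lambda>w. BM c b (of_bool j * compensation c b t (mitigated_loss c d w)))
      \<in> loss_space \<rightarrow>\<^sub>M count_space UNIV"
    by (rule measurable_BM[OF b _ pos]) measurable
  then have meas: "transition c t b i d \<iota> j \<in> loss_space \<rightarrow>\<^sub>M count_space UNIV"
    unfolding transition_def[abs_def]
    by (cases \<iota>) (auto intro: measurable_compose[OF _ measurable_count_space])
  show ?thesis
    unfolding measurable_count_space_eq2[OF finite_states]
    using transition_state[OF b i t] measurable_sets[OF meas] by auto
qed

text \<open>
  State and decisions have finite ranges, so it suffices to fix their values one after the other and
  to vary the loss only.
\<close>

lemma measurable_transition_filt: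
  assumes t: "t \<in> {1..horizon c}"
    and X: "X \<in> filt c (t - 1) \<rightarrow>\<^sub>M count_space (states c)"
    and d: "d \<in> filt c (t - 1) \<rightarrow>\<^sub>M count_space (mitigations c)"
    and \<iota>: "\<iota> \<in> filt c (t - 1) \<rightarrow>\<^sub>M count_space UNIV"
    and j: "j \<in> filt c t \<rightarrow>\<^sub>M count_space UNIV"
  shows "(\<lambda>\<omega>. transition c t (fst (X \<omega>)) (snd (X \<omega>)) (d \<omega>) (\<iota> \<omega>) (j \<omega>) (\<omega> t))
    \<in> filt c t \<rightarrow>\<^sub>M count_space (states c)"
proof -
  have up: "f \<in> filt c (t - 1) \<rightarrow>\<^sub>M N \<Longrightarrow> f \<in> filt c t \<rightarrow>\<^sub>M N" for f :: "scenario \<Rightarrow> 'x" and N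
    by (rule filt_mono[of "t - 1" t]) (simp_all add: diff_le_self)
  have coord: "(\<lambda>\<omega>. \<omega> t) \<in> filt c t \<rightarrow>\<^sub>M loss_space"
    using t by (intro measurable_coordinate_filt) auto
  let ?T = "\<lambda>x d' \<iota>' j' \<omega>. transition c t (fst x) (snd x) d' \<iota>' j' (\<omega> t)"
  let ?N = "count_space (states c)"
  have fixed: "?T x d' \<iota>' j' \<in> filt c t \<rightarrow>\<^sub>M ?N" if "x \<in> states c" for x d' \<iota>' j'
    using that by (intro measurable_compose[OF coord measurable_transition] t) auto
  have "(\<lambda>\<omega>. ?T x d' \<iota>' (j \<omega>) \<omega>) \<in> filt c t \<rightarrow>\<^sub>M ?N" if "x \<in> states c" for x d' \<iota>'
    by (rule measurable_compose_countable'[where f="\<lambda>j'. ?T x d' \<iota>' j'", OF fixed[OF that] j]) simp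
  then have "(\<lambda>\<omega>. ?T x d' (\<iota> \<omega>) (j \<omega>) \<omega>) \<in> filt c t \<rightarrow>\<^sub>M ?N" if "x \<in> states c" for x d'
    using that by (intro measurable_compose_countable'[where f="\<lambda>\<iota>' \<omega>. ?T x d' \<iota>' (j \<omega>) \<omega>", OF _ up[OF \<iota>]]) simp_all
  then have "(\<lambda>\<omega>. ?T x (d \<omega>) (\<iota> \<omega>) (j \<omega>) \<omega>) \<in> filt c t \<rightarrow>\<^sub>M ?N" if "x \<in> states c" for x
    using that countable_finite[OF finite_mitigations]
    by (intro measurable_compose_countable'[where f="\<lambda>d' \<omega>. ?T x d' (\<iota> \<omega>) (j \<omega>) \<omega>", OF _ up[OF d]]) simp_all
  then show ?thesis
    using countable_finite[OF finite_states]
    by (intro measurable_compose_countable'[where f="\<lambda>x \<omega>. ?T x (d \<omega>) (\<iota> \<omega>) (j \<omega>) \<omega>", OF _ up[OF X]]) simp_all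
qed

lemma policyD:
  assumes "\<pi> \<in> policies c" "t \<in> {1..horizon c}"
  shows "mitigate \<pi> t \<in> filt c (t - 1) \<rightarrow>\<^sub>M count_space (mitigations c)"
    "insure \<pi> t \<in> filt c (t - 1) \<rightarrow>\<^sub>M count_space UNIV"
    "claim \<pi> t \<in> filt c t \<rightarrow>\<^sub>M count_space UNIV"
    "\<And>\<omega>. \<omega> \<in> space (prob_law c) \<Longrightarrow> claim \<pi> t \<omega> \<Longrightarrow> insure \<pi> t \<omega>"
  using assms unfolding policies_def by auto

lemma measurable_ctrl_state:
  assumes \<pi>: "\<pi> \<in> policies c"
  shows "t \<le> horizon c \<Longrightarrow> ctrl_state c \<pi> t \<in> filt c t \<rightarrow>\<^sub>M count_space (states c)"
proof (induction t)
  case 0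
  have "ctrl_state c \<pi> 0 = (\<lambda>_. (0, No))" by auto
  then show ?case using initial_state by simp
next
  case (Suc t)
  have "Suc t \<in> {1..horizon c}" using Suc.prems by simp
  then show ?case
    using measurable_transition_filt[of "Suc t" "ctrl_state c \<pi> t"] Suc policyD[OF \<pi>, of "Suc t"]
    by simp
qed

lemma ctrl_state_in_states:
  "\<pi> \<in> policies c \<Longrightarrow> t \<le> horizon c \<Longrightarrow> \<omega> \<in> space (prob_law c) \<Longrightarrow> ctrl_state c \<pi> t \<omega> \<in> states c"
  using measurable_space[OF measurable_ctrl_state, of \<pi> t \<omega>] by simp

lemma mitigate_in_mitigations:
  "\<pi> \<in> policies c \<Longrightarrow> t \<in> {1..horizon c} \<Longrightarrow> \<omega> \<in> space (prob_law c) \<Longrightarrow> mitigate \<pi> t \<omega> \<in> mitigations c"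
  using measurable_space[OF policyD(1), of \<pi> t \<omega>] by simp

lemma BM_between:
  assumes "b \<in> levels c" "0 \<le> x"
  shows "BM c b x \<in> {bm_min c b..bm_max c b}"
proof -
  have "finite (BM c b ` {0..})"
    by (rule finite_subset[OF _ finite_levels[of c]]) (auto intro: BM_level[OF assms(1)])
  then have "BM c b x \<le> bm_max c b"
    unfolding bm_max_def using assms(2) by (intro Max_ge) auto
  moreover have "bm_min c b \<le> BM c b x"
    unfolding bm_min_def using BM_mono[OF assms(1)] assms(2) by (auto simp: monotone_on_def)
  ultimately show ?thesis by simp
qed

lemma bm_min_level: "b \<in> levels c \<Longrightarrow> bm_min c b \<in> levels c"
  unfolding bm_min_def by (rule BM_level) simp_all

end

section \<open>The Bellman equation\<close>

text \<open>
  The least value of the cost of year \<open>t\<close> plus the cost to go, over the claim decision alone: the two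
  arguments of \<open>min\<close> belong to not claiming and to claiming.
\<close>

definition best_cost ::
    "cyber_model \<Rightarrow> (nat \<Rightarrow> int \<Rightarrow> contract \<Rightarrow> real) \<Rightarrow> nat \<Rightarrow> int \<Rightarrow> contract \<Rightarrow> nat \<Rightarrow> bool \<Rightarrow> loss \<Rightarrow> real"
  where
  "best_cost c V t b i d \<iota> w = fixed_cost c t b i d \<iota> + mitigated_loss c d w +
     (if \<iota> then
        (let x = compensation c b t (mitigated_loss c d w)
         in min (V t (bm_min c b) On) (V t (BM c b x) On - x))
      else V t (fst (BM0 c b i)) (snd (BM0 c b i)))"

definition cost_to_go ::
    "cyber_model \<Rightarrow> (nat \<Rightarrow> int \<Rightarrow> contract \<Rightarrow> real) \<Rightarrow> nat \<Rightarrow> int \<Rightarrow> contract \<Rightarrow> nat \<Rightarrow> bool \<Rightarrow> bool \<Rightarrow> loss \<Rightarrow> real"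
  where
  "cost_to_go c V t b i d \<iota> j w = stage_cost c t b i d \<iota> j w +
     (case transition c t b i d \<iota> j w of (b', i') \<Rightarrow> V t b' i')"

lemma best_cost_le:
  assumes "j \<Longrightarrow> \<iota>"
  shows "best_cost c V t b i d \<iota> w \<le> cost_to_go c V t b i d \<iota> j w"
  using assms
  by (cases \<iota>; cases j)
    (auto simp: best_cost_def cost_to_go_def stage_cost_def transition_def bm_min_def Let_def split_beta)

context cyber_provisioning
begin

text \<open>
  The claim regions are indexed by the level to which a claim leads.  Since that level lies between
  \<open>bm_min\<close> and \<open>bm_max\<close>, their union amounts to one comparison, between the compensation and the cost of
  moving to that level.
\<close>

lemma alg_claim_iff:
  assumes "b \<in> levels c" "t \<in> {1..horizon c}"
  shows "alg_claim c V dh ih t b i w \<longleftrightarrow> ih t b i \<and>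
    V t (BM c b (compensation c b t (mitigated_loss c (dh t b i) w))) On - V t (bm_min c b) On
      < compensation c b t (mitigated_loss c (dh t b i) w)"
proof -
  let ?x = "compensation c b t (mitigated_loss c (dh t b i) w)"
  have "0 \<le> ?x"
    by (rule compensation_bounds(1)[OF assms(1,2) mitigated_loss_nonneg])
  then show ?thesis
    using BM_between[OF assms(1), of ?x]
    unfolding alg_claim_def claim_region_def claim_threshold_def by auto
qed

lemma cost_to_go_alg_claim:
  assumes "b \<in> levels c" "t \<in> {1..horizon c}"
  shows "cost_to_go c V t b i (dh t b i) (ih t b i) (alg_claim c V dh ih t b i w) w
    = best_cost c V t b i (dh t b i) (ih t b i) w"
proof (cases "ih t b i")
  case False
  then show ?thesis
    by (simp add: best_cost_def cost_to_go_def stage_cost_def transition_def split_beta)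
next
  case True
  then show ?thesis
    by (cases "alg_claim c V dh ih t b i w")
      (simp_all add: alg_claim_iff[OF assms] best_cost_def cost_to_go_def stage_cost_def
        transition_def bm_min_def Let_def)
qed

lemma best_cost_nonneg:
  assumes V: "\<And>b i. b \<in> levels c \<Longrightarrow> i \<in> contracts c \<Longrightarrow> 0 \<le> V t b i"
    and b: "b \<in> levels c" and i: "i \<in> contracts c" and t: "t \<in> {1..horizon c}"
    and d: "d \<in> mitigations c"
  shows "0 \<le> best_cost c V t b i d \<iota> w"
proof -
  let ?x = "compensation c b t (mitigated_loss c d w)"
  note x = compensation_bounds[OF b t mitigated_loss_nonneg, of c d w]
  have "0 \<le> V t (bm_min c b) On" "0 \<le> V t (BM c b ?x) On"
    using x(1) by (intro V bm_min_level BM_level b On_contract)+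
  moreover have "0 \<le> V t (fst (BM0 c b i)) (snd (BM0 c b i))"
    using BM0_state[OF b i] by (intro V) auto
  moreover have "0 \<le> fixed_cost c t b i d \<iota>" by (rule fixed_cost_nonneg[OF b t d])
  ultimately show ?thesis
    using x mitigated_loss_nonneg[of c d w] unfolding best_cost_def Let_def by (cases \<iota>) auto
qed

lemma measurable_best_cost:
  assumes b: "b \<in> levels c" and t: "t \<in> {1..horizon c}"
  shows "best_cost c V t b i d \<iota> \<in> borel_measurable loss_space"
proof -
  have "(\<lambda>w. BM c b (compensation c b t (mitigated_loss c d w))) \<in> loss_space \<rightarrow>\<^sub>M count_space UNIV"
    by (rule measurable_BM[OF b _ compensation_bounds(1)[OF b t mitigated_loss_nonneg]]) measurable
  then have [measurable]: "(\<lambda>w. V t (BM c b (compensation c b t (mitigated_loss c d w))) On)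
      \<in> borel_measurable loss_space"
    by (rule measurable_compose) simp
  show ?thesis
    unfolding best_cost_def[abs_def] Let_def by (cases \<iota>) simp_all
qed

text \<open>
  The quantity minimised by the algorithm is the expected \<open>best_cost\<close>.  Apart from the loss itself,
  \<open>best_cost\<close> is a bounded random variable \<open>K\<close> plus a constant, and \<open>K\<close> has expectation \<open>alg_H\<close> because
  \<open>min u (v - x) = u - (x - (v - u))\<^sup>+\<close>.  The expected loss may be infinite; then both sides are.
\<close>

lemma expected_best_cost:
  assumes V: "\<And>b i. b \<in> levels c \<Longrightarrow> i \<in> contracts c \<Longrightarrow> 0 \<le> V t b i"
    and b: "b \<in> levels c" and i: "i \<in> contracts c" and t: "t \<in> {1..horizon c}"
    and d: "d \<in> mitigations c"
  shows "enn2ereal (\<integral>\<^sup>+\<omega>. ennreal (best_cost c V t b i d \<iota> (\<omega> t)) \<partial>prob_law c) = alg_G c V t b i d \<iota>"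
proof -
  let ?L = "\<lambda>\<omega>. mitigated_loss c d (\<omega> t)"
  let ?x = "\<lambda>\<omega>. compensation c b t (?L \<omega>)"
  let ?F = "fixed_cost c t b i d \<iota>"
  let ?U = "V t (bm_min c b) On"
  note coord [measurable] = measurable_coordinate[OF t]
  note x = compensation_bounds[OF b t mitigated_loss_nonneg[of c d]]
  have F: "0 \<le> ?F" by (rule fixed_cost_nonneg[OF b t d])
  define K where "K \<omega> = best_cost c V t b i d \<iota> (\<omega> t) - ?F - ?L \<omega>" for \<omega>
  have best: "best_cost c V t b i d \<iota> (\<omega> t) = ?F + ?L \<omega> + K \<omega>" for \<omega>
    unfolding K_def by simp
  have best_nonneg: "0 \<le> best_cost c V t b i d \<iota> w" for w
    using V b i t d by (rule best_cost_nonneg)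
  have meas [measurable]: "(\<lambda>\<omega>. best_cost c V t b i d \<iota> (\<omega> t)) \<in> borel_measurable (prob_law c)"
    by (rule measurable_compose[OF coord measurable_best_cost[OF b t]])
  have level [measurable]: "(\<lambda>\<omega>. BM c b (?x \<omega>)) \<in> prob_law c \<rightarrow>\<^sub>M count_space UNIV"
    by (rule measurable_BM[OF b _ x(1)]) measurable
  have K: "integrable (prob_law c) K \<and> (\<integral>\<omega>. K \<omega> \<partial>prob_law c) = alg_H c V t b i d \<iota>"
  proof (cases \<iota>)
    case False
    then have "K = (\<lambda>_. V t (fst (BM0 c b i)) (snd (BM0 c b i)))"
      unfolding K_def best_cost_def by auto
    then show ?thesis
      using False by (simp add: alg_H_def P.prob_space)
  next
    case True
    let ?s = "\<lambda>b' \<omega>. of_bool (BM c b (?x \<omega>) = b') * max (?x \<omega> - claim_threshold c V t b b') 0"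
    have int: "integrable (prob_law c) (?s b')" for b'
    proof (rule P.integrable_const_bound)
      show "AE \<omega> in prob_law c. norm (?s b' \<omega>) \<le> max_comp c b t + \<bar>claim_threshold c V t b b'\<bar>"
      proof (rule AE_I2)
        fix \<omega>
        have "0 \<le> ?x \<omega>" "?x \<omega> \<le> max_comp c b t" using x(1) x(3) by auto
        then have "0 \<le> max (?x \<omega> - claim_threshold c V t b b') 0"
          "max (?x \<omega> - claim_threshold c V t b b') 0 \<le> max_comp c b t + \<bar>claim_threshold c V t b b'\<bar>"
          by linarith+
        then show "norm (?s b' \<omega>) \<le> max_comp c b t + \<bar>claim_threshold c V t b b'\<bar>"
          by (cases "BM c b (?x \<omega>) = b'") simp_all
      qed
      have "(\<lambda>\<omega>. of_bool (BM c b (?x \<omega>) = b') :: real) \<in> borel_measurable (prob_law c)"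
        by (rule measurable_compose[OF level]) simp
      then show "?s b' \<in> borel_measurable (prob_law c)"
        by measurable
    qed
    \<comment> \<open>Exactly one summand survives, the one for the level reached by a claim.\<close>
    have eq: "K \<omega> = ?U - (\<Sum>b'=bm_min c b..bm_max c b. ?s b' \<omega>)" for \<omega>
    proof -
      have "(\<Sum>b'=bm_min c b..bm_max c b. ?s b' \<omega>) =
          (\<Sum>b'=bm_min c b..bm_max c b.
             if BM c b (?x \<omega>) = b' then max (?x \<omega> - claim_threshold c V t b b') 0 else 0)"
        by (intro sum.cong) auto
      also have "\<dots> = max (?x \<omega> - claim_threshold c V t b (BM c b (?x \<omega>))) 0"
        using BM_between[OF b x(1)[of "\<omega> t"]] by simp
      finally show ?thesis
        unfolding K_def best_cost_def claim_threshold_def Let_def using True by (simp add: min_def max_def)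
    qed
    let ?S = "\<lambda>\<omega>. \<Sum>b'=bm_min c b..bm_max c b. ?s b' \<omega>"
    have S: "integrable (prob_law c) ?S"
      "(\<integral>\<omega>. ?S \<omega> \<partial>prob_law c) = (\<Sum>b'=bm_min c b..bm_max c b. \<integral>\<omega>. ?s b' \<omega> \<partial>prob_law c)"
      by (intro Bochner_Integration.integrable_sum Bochner_Integration.integral_sum int)+
    have "integrable (prob_law c) (\<lambda>\<omega>. ?U - ?S \<omega>)"
      by (intro Bochner_Integration.integrable_diff S(1)) simp
    moreover have "(\<integral>\<omega>. ?U - ?S \<omega> \<partial>prob_law c) = ?U - (\<integral>\<omega>. ?S \<omega> \<partial>prob_law c)"
      by (subst Bochner_Integration.integral_diff[OF _ S(1)]) (simp_all add: P.prob_space)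
    moreover have "alg_H c V t b i d \<iota> = ?U - (\<Sum>b'=bm_min c b..bm_max c b. \<integral>\<omega>. ?s b' \<omega> \<partial>prob_law c)"
      unfolding alg_H_def using True by (rule if_P)
    ultimately show ?thesis
      unfolding eq[abs_def] S(2) by (intro conjI) simp_all
  qed
  show ?thesis
  proof (cases "(\<integral>\<^sup>+\<omega>. ennreal (?L \<omega>) \<partial>prob_law c) = \<infinity>")
    case True
    have "(\<integral>\<^sup>+\<omega>. ennreal (?L \<omega>) \<partial>prob_law c)
        \<le> (\<integral>\<^sup>+\<omega>. ennreal (best_cost c V t b i d \<iota> (\<omega> t)) + ennreal \<bar>K \<omega>\<bar> \<partial>prob_law c)"
    proof (intro nn_integral_mono)
      fix \<omega>
      have "?L \<omega> \<le> best_cost c V t b i d \<iota> (\<omega> t) + \<bar>K \<omega>\<bar>"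
        using F best[of \<omega>] by linarith
      then show "ennreal (?L \<omega>) \<le> ennreal (best_cost c V t b i d \<iota> (\<omega> t)) + ennreal \<bar>K \<omega>\<bar>"
        unfolding ennreal_plus[OF best_nonneg abs_ge_zero, symmetric] by (rule ennreal_leI)
    qed
    also have "\<dots> = (\<integral>\<^sup>+\<omega>. ennreal (best_cost c V t b i d \<iota> (\<omega> t)) \<partial>prob_law c)
        + (\<integral>\<^sup>+\<omega>. ennreal \<bar>K \<omega>\<bar> \<partial>prob_law c)"
      using K by (intro nn_integral_add) auto
    finally have "(\<integral>\<^sup>+\<omega>. ennreal (best_cost c V t b i d \<iota> (\<omega> t)) \<partial>prob_law c) = \<infinity>"
      using True K by (auto simp: integrable_iff_bounded top_unique less_top)
    then show ?thesis
      unfolding alg_G_def using True by simp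
  next
    case False
    then have L: "integrable (prob_law c) ?L"
      using mitigated_loss_nonneg[of c d] by (simp add: integrable_iff_bounded less_top)
    have int: "integrable (prob_law c) (\<lambda>\<omega>. best_cost c V t b i d \<iota> (\<omega> t))"
      unfolding best using L K by simp
    have "(\<integral>\<omega>. best_cost c V t b i d \<iota> (\<omega> t) \<partial>prob_law c)
        = ?F + (\<integral>\<omega>. ?L \<omega> \<partial>prob_law c) + alg_H c V t b i d \<iota>"
      unfolding best using L K by (simp add: P.prob_space)
    moreover have "0 \<le> (\<integral>\<omega>. best_cost c V t b i d \<iota> (\<omega> t) \<partial>prob_law c)"
      using best_nonneg by simp
    ultimately show ?thesis
      unfolding alg_G_def
      using nn_integral_eq_integral[OF int] nn_integral_eq_integral[OF L] best_nonneg
        mitigated_loss_nonneg[of c d] by simp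
  qed
qed

end

text \<open>
  The tables \<open>V\<close>, \<open>dh\<close>, \<open>ih\<close> stand for the result of one execution of the backward step, with whatever
  minimisers it has picked.
\<close>

locale algorithm_run = cyber_provisioning c for c +
  fixes V :: "nat \<Rightarrow> int \<Rightarrow> contract \<Rightarrow> real"
    and dh :: "nat \<Rightarrow> int \<Rightarrow> contract \<Rightarrow> nat"
    and ih :: "nat \<Rightarrow> int \<Rightarrow> contract \<Rightarrow> bool"
  assumes run: "alg_run c V dh ih"
begin

lemma V_horizon: "b \<in> levels c \<Longrightarrow> i \<in> contracts c \<Longrightarrow> V (horizon c) b i = 0"
  using run unfolding alg_run_def by blast

lemma dh_mitigation:
  "t \<in> {1..horizon c} \<Longrightarrow> b \<in> levels c \<Longrightarrow> i \<in> contracts c \<Longrightarrow> dh t b i \<in> mitigations c"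
  using run unfolding alg_run_def by blast

lemma alg_G_minimal:
  assumes "t \<in> {1..horizon c}" "b \<in> levels c" "i \<in> contracts c"
  shows "d \<in> mitigations c \<Longrightarrow> alg_G c V t b i (dh t b i) (ih t b i) \<le> alg_G c V t b i d \<iota>"
    and "ereal (V (t - 1) b i) = ereal (exp (- rate c)) * alg_G c V t b i (dh t b i) (ih t b i)"
proof -
  let ?S = "{alg_G c V t b i d \<iota> | d \<iota>. d \<in> mitigations c}"
  show min: "alg_G c V t b i (dh t b i) (ih t b i) \<le> alg_G c V t b i d \<iota>" if "d \<in> mitigations c" for d \<iota>
    using run that assms unfolding alg_run_def by blast
  have "?S = (\<lambda>(d, \<iota>). alg_G c V t b i d \<iota>) ` (mitigations c \<times> UNIV)" by force
  then have "finite ?S" using finite_mitigations[of c] by simp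
  then have "Min ?S = alg_G c V t b i (dh t b i) (ih t b i)"
    using min dh_mitigation[OF assms] by (intro Min_eqI) auto
  moreover have "ereal (V (t - 1) b i) = ereal (exp (- rate c)) * Min ?S"
    using run assms unfolding alg_run_def by blast
  ultimately show "ereal (V (t - 1) b i) = ereal (exp (- rate c)) * alg_G c V t b i (dh t b i) (ih t b i)"
    by simp
qed

lemma V_nonneg:
  assumes "t \<le> horizon c"
  shows "b \<in> levels c \<Longrightarrow> i \<in> contracts c \<Longrightarrow> 0 \<le> V t b i"
  using assms
proof (induction t arbitrary: b i rule: inc_induct)
  case base
  then show ?case by (simp add: V_horizon)
next
  case (step t)
  then have t: "Suc t \<in> {1..horizon c}" by simp
  have "alg_G c V (Suc t) b i (dh (Suc t) b i) (ih (Suc t) b i) = enn2ereal (\<integral>\<^sup>+\<omega>.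
      ennreal (best_cost c V (Suc t) b i (dh (Suc t) b i) (ih (Suc t) b i) (\<omega> (Suc t))) \<partial>prob_law c)"
    by (rule expected_best_cost[symmetric]) (fact step.IH step.prems t dh_mitigation[OF t step.prems])+
  then have "0 \<le> alg_G c V (Suc t) b i (dh (Suc t) b i) (ih (Suc t) b i)"
    by simp
  then have "0 \<le> ereal (V t b i)"
    using alg_G_minimal(2)[OF t step.prems] by simp
  then show ?case by simp
qed

lemma alg_G_eq_expected_best_cost:
  assumes t: "t \<in> {1..horizon c}" and b: "b \<in> levels c" and i: "i \<in> contracts c"
    and d: "d \<in> mitigations c"
  shows "enn2ereal (\<integral>\<^sup>+\<omega>. ennreal (best_cost c V t b i d \<iota> (\<omega> t)) \<partial>prob_law c) = alg_G c V t b i d \<iota>"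
proof (rule expected_best_cost[OF _ b i t d])
  show "0 \<le> V t b' i'" if "b' \<in> levels c" "i' \<in> contracts c" for b' i'
    using V_nonneg[OF _ that] t by simp
qed

lemma bellman_eq:
  assumes t: "t \<in> {1..horizon c}" and b: "b \<in> levels c" and i: "i \<in> contracts c"
  shows "ennreal (V (t - 1) b i) = ennreal (exp (- rate c)) *
    (\<integral>\<^sup>+\<omega>. ennreal (best_cost c V t b i (dh t b i) (ih t b i) (\<omega> t)) \<partial>prob_law c)"
proof -
  have le: "t - 1 \<le> horizon c" using t by auto
  have "enn2ereal (ennreal (V (t - 1) b i)) = ereal (V (t - 1) b i)"
    using V_nonneg[OF le b i] by (rule enn2ereal_ennreal)
  also have "\<dots> = enn2ereal (ennreal (exp (- rate c)) *
      (\<integral>\<^sup>+\<omega>. ennreal (best_cost c V t b i (dh t b i) (ih t b i) (\<omega> t)) \<partial>prob_law c))"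
    unfolding times_ennreal.rep_eq alg_G_eq_expected_best_cost[OF t b i dh_mitigation[OF t b i]]
      alg_G_minimal(2)[OF t b i] by simp
  finally show ?thesis by (simp add: enn2ereal_inject)
qed

lemma bellman_le:
  assumes t: "t \<in> {1..horizon c}" and b: "b \<in> levels c" and i: "i \<in> contracts c"
    and d: "d \<in> mitigations c"
  shows "ennreal (V (t - 1) b i) \<le> ennreal (exp (- rate c)) *
    (\<integral>\<^sup>+\<omega>. ennreal (best_cost c V t b i d \<iota> (\<omega> t)) \<partial>prob_law c)"
proof -
  have "(\<integral>\<^sup>+\<omega>. ennreal (best_cost c V t b i (dh t b i) (ih t b i) (\<omega> t)) \<partial>prob_law c)
      \<le> (\<integral>\<^sup>+\<omega>. ennreal (best_cost c V t b i d \<iota> (\<omega> t)) \<partial>prob_law c)"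
    unfolding less_eq_ennreal.rep_eq alg_G_eq_expected_best_cost[OF t b i dh_mitigation[OF t b i]]
      alg_G_eq_expected_best_cost[OF t b i d]
    by (rule alg_G_minimal(1)[OF t b i d])
  then show ?thesis
    unfolding bellman_eq[OF t b i] by (rule mult_left_mono) simp
qed

end

section \<open>Expected total costs\<close>

definition incurred_cost :: "cyber_model \<Rightarrow> policy \<Rightarrow> nat \<Rightarrow> scenario \<Rightarrow> real" where
  "incurred_cost c \<pi> s \<omega> = stage_cost c s (fst (ctrl_state c \<pi> (s - 1) \<omega>)) (snd (ctrl_state c \<pi> (s - 1) \<omega>))
     (mitigate \<pi> s \<omega>) (insure \<pi> s \<omega>) (claim \<pi> s \<omega>) (\<omega> s)"

context cyber_provisioning
begin

lemma incurred_cost_nonneg: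
  assumes "\<pi> \<in> policies c" "s \<in> {1..horizon c}" "\<omega> \<in> space (prob_law c)"
  shows "0 \<le> incurred_cost c \<pi> s \<omega>"
proof -
  have "s - 1 \<le> horizon c" using assms(2) by auto
  then show ?thesis
    unfolding incurred_cost_def
    using ctrl_state_in_states[OF assms(1) _ assms(3), of "s - 1"] mitigate_in_mitigations[OF assms] assms(2)
    by (intro stage_cost_nonneg) (auto simp: mem_Times_iff)
qed

lemma measurable_incurred_cost:
  assumes \<pi>: "\<pi> \<in> policies c" and s: "s \<in> {1..horizon c}"
  shows "incurred_cost c \<pi> s \<in> borel_measurable (prob_law c)"
proof -
  have le: "s - 1 \<le> horizon c" "s \<le> horizon c" using s by auto
  note p = policyD[OF \<pi> s]
  note coord [measurable] = measurable_coordinate[OF s]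
  have X: "ctrl_state c \<pi> (s - 1) \<in> prob_law c \<rightarrow>\<^sub>M count_space (states c)"
    using le by (intro filt_measurable[OF _ measurable_ctrl_state[OF \<pi>]])
  have d: "mitigate \<pi> s \<in> prob_law c \<rightarrow>\<^sub>M count_space (mitigations c)"
    using le p(1) by (intro filt_measurable)
  have \<iota>: "insure \<pi> s \<in> prob_law c \<rightarrow>\<^sub>M count_space UNIV"
    using le p(2) by (intro filt_measurable)
  have j: "claim \<pi> s \<in> prob_law c \<rightarrow>\<^sub>M count_space UNIV"
    using le p(3) by (intro filt_measurable)
  let ?g = "\<lambda>x d' \<iota>' j' \<omega>. stage_cost c s (fst x) (snd x) d' \<iota>' j' (\<omega> s)"
  have "?g x d' \<iota>' j' \<in> borel_measurable (prob_law c)" for x d' \<iota>' j'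
    unfolding stage_cost_def by measurable
  then have "(\<lambda>\<omega>. ?g x d' \<iota>' (claim \<pi> s \<omega>) \<omega>) \<in> borel_measurable (prob_law c)" for x d' \<iota>'
    by (rule measurable_compose_countable'[where f="\<lambda>j'. ?g x d' \<iota>' j'", OF _ j]) simp
  then have "(\<lambda>\<omega>. ?g x d' (insure \<pi> s \<omega>) (claim \<pi> s \<omega>) \<omega>) \<in> borel_measurable (prob_law c)" for x d'
    by (rule measurable_compose_countable'[where f="\<lambda>\<iota>' \<omega>. ?g x d' \<iota>' (claim \<pi> s \<omega>) \<omega>", OF _ \<iota>]) simp
  then have "(\<lambda>\<omega>. ?g x (mitigate \<pi> s \<omega>) (insure \<pi> s \<omega>) (claim \<pi> s \<omega>) \<omega>) \<in> borel_measurable (prob_law c)" for x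
    by (rule measurable_compose_countable'[where f="\<lambda>d' \<omega>. ?g x d' (insure \<pi> s \<omega>) (claim \<pi> s \<omega>) \<omega>", OF _ d])
      (rule countable_finite[OF finite_mitigations])
  then show ?thesis
    unfolding incurred_cost_def[abs_def]
    by (rule measurable_compose_countable'[where f="\<lambda>x \<omega>. ?g x (mitigate \<pi> s \<omega>) (insure \<pi> s \<omega>) (claim \<pi> s \<omega>) \<omega>", OF _ X])
      (rule countable_finite[OF finite_states])
qed

lemma future_cost_step:
  assumes "t < horizon c"
  shows "future_cost c \<pi> t \<omega> = exp (- rate c) * (incurred_cost c \<pi> (Suc t) \<omega> + future_cost c \<pi> (Suc t) \<omega>)"
proof -
  let ?f = "\<lambda>r s. exp (- (real (s - r) * rate c)) * incurred_cost c \<pi> s \<omega>"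
  have fc: "future_cost c \<pi> r \<omega> = (\<Sum>s=r+1..horizon c. ?f r s)" for r
    unfolding future_cost_def incurred_cost_def ..
  have "future_cost c \<pi> t \<omega> = ?f t (Suc t) + (\<Sum>s=Suc t + 1..horizon c. ?f t s)"
    unfolding fc using assms by (simp add: sum.atLeast_Suc_atMost)
  also have "(\<Sum>s=Suc t + 1..horizon c. ?f t s) = (\<Sum>s=Suc t + 1..horizon c. exp (- rate c) * ?f (Suc t) s)"
  proof (intro sum.cong refl)
    fix s assume "s \<in> {Suc t + 1..horizon c}"
    then have shift: "real (s - t) = 1 + real (s - Suc t)" by (simp add: of_nat_diff)
    have "- (real (s - t) * rate c) = - rate c + - (real (s - Suc t) * rate c)"
      unfolding shift by (simp add: distrib_right del: of_nat_diff)
    then show "?f t s = exp (- rate c) * ?f (Suc t) s"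
      by (simp only: exp_add mult.assoc)
  qed
  also have "\<dots> = exp (- rate c) * future_cost c \<pi> (Suc t) \<omega>"
    unfolding fc by (simp add: sum_distrib_left)
  finally show ?thesis by (simp add: distrib_left)
qed

lemma future_cost_horizon: "future_cost c \<pi> (horizon c) \<omega> = 0"
  unfolding future_cost_def by simp

lemma future_cost_nonneg:
  assumes "\<pi> \<in> policies c" "\<omega> \<in> space (prob_law c)"
  shows "t \<le> horizon c \<Longrightarrow> 0 \<le> future_cost c \<pi> t \<omega>"
proof (induction t rule: inc_induct)
  case (step t)
  then show ?case
    using incurred_cost_nonneg[OF assms(1) _ assms(2), of "Suc t"] by (simp add: future_cost_step)
qed (simp add: future_cost_horizon)

lemma measurable_future_cost:
  assumes "\<pi> \<in> policies c"
  shows "t \<le> horizon c \<Longrightarrow> future_cost c \<pi> t \<in> borel_measurable (prob_law c)"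
proof (induction t rule: inc_induct)
  case base
  show ?case unfolding future_cost_horizon[abs_def] by simp
next
  case (step t)
  then have "(\<lambda>\<omega>. exp (- rate c) * (incurred_cost c \<pi> (Suc t) \<omega> + future_cost c \<pi> (Suc t) \<omega>)) \<in> borel_measurable (prob_law c)"
    using measurable_incurred_cost[OF assms, of "Suc t"] by simp
  then show ?case
    by (rule measurable_cong[THEN iffD1, rotated]) (rule future_cost_step[OF step.hyps(2), symmetric])
qed

text \<open>
  The filtration starts with the trivial \<open>\<sigma>\<close>-algebra, so the conditional expectation is a constant, and
  integrating it identifies the constant.
\<close>

lemma policy_value_0:
  assumes \<pi>: "\<pi> \<in> policies c" and \<omega>: "\<omega> \<in> space (prob_law c)"
  shows "policy_value c \<pi> 0 \<omega> = (\<integral>\<^sup>+\<omega>. ennreal (future_cost c \<pi> 0 \<omega>) \<partial>prob_law c)"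
proof -
  let ?f = "\<lambda>\<omega>. ennreal (future_cost c \<pi> 0 \<omega>)"
  let ?E = "nn_cond_exp (prob_law c) (filt c 0) ?f"
  have "subalgebra (prob_law c) (filt c 0)"
    unfolding subalgebra_def using sets_filt_subset[of 0] by simp
  then interpret finite_measure_subalgebra "prob_law c" "filt c 0"
    by unfold_locales
  have f: "?f \<in> borel_measurable (prob_law c)"
    using measurable_future_cost[OF \<pi>] by simp
  have "(\<integral>\<^sup>+\<omega>. ?f \<omega> \<partial>prob_law c) = (\<integral>\<^sup>+\<omega>. 1 * ?E \<omega> \<partial>prob_law c)"
    using nn_cond_exp_intg[of "\<lambda>_. 1" ?f] f by simp
  also have "\<dots> = (\<integral>\<^sup>+\<omega>'. ?E \<omega> \<partial>prob_law c)"
    using filt_0_constant[OF borel_measurable_nn_cond_exp _ \<omega>] by (intro nn_integral_cong) simp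
  also have "\<dots> = ?E \<omega>"
    by (simp add: P.emeasure_space_1)
  finally show ?thesis
    using horizon unfolding policy_value_def by simp
qed

end

context algorithm_run
begin

section \<open>The computed values bound the cost of every policy\<close>

abbreviation expected_V where
  "expected_V \<pi> t \<equiv> (\<integral>\<^sup>+\<omega>. ennreal (case ctrl_state c \<pi> t \<omega> of (b, i) \<Rightarrow> V t b i) \<partial>prob_law c)"

lemma cost_to_go_ctrl:
  "cost_to_go c V (Suc t) (fst (ctrl_state c \<pi> t \<omega>)) (snd (ctrl_state c \<pi> t \<omega>))
      (mitigate \<pi> (Suc t) \<omega>) (insure \<pi> (Suc t) \<omega>) (claim \<pi> (Suc t) \<omega>) (\<omega> (Suc t))
    = incurred_cost c \<pi> (Suc t) \<omega> + (case ctrl_state c \<pi> (Suc t) \<omega> of (b, i) \<Rightarrow> V (Suc t) b i)"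
  unfolding cost_to_go_def incurred_cost_def by simp

lemma measurable_V_ctrl:
  assumes "\<pi> \<in> policies c" "t \<le> horizon c"
  shows "(\<lambda>\<omega>. case ctrl_state c \<pi> t \<omega> of (b, i) \<Rightarrow> V t b i) \<in> borel_measurable (prob_law c)"
  using filt_measurable[OF assms(2) measurable_ctrl_state[OF assms]]
  by (rule measurable_compose) simp

lemma V_ctrl_nonneg:
  assumes "\<pi> \<in> policies c" "t \<le> horizon c" "\<omega> \<in> space (prob_law c)"
  shows "0 \<le> (case ctrl_state c \<pi> t \<omega> of (b, i) \<Rightarrow> V t b i)"
  using ctrl_state_in_states[OF assms] V_nonneg[OF assms(2)] by auto

lemma measurable_decision:
  assumes \<pi>: "\<pi> \<in> policies c" and t: "t < horizon c"
  shows "(\<lambda>\<omega>. (ctrl_state c \<pi> t \<omega>, mitigate \<pi> (Suc t) \<omega>, insure \<pi> (Suc t) \<omega>))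
    \<in> filt c t \<rightarrow>\<^sub>M count_space (states c \<times> mitigations c \<times> UNIV)"
proof -
  have t': "Suc t \<in> {1..horizon c}" using t by simp
  have X: "ctrl_state c \<pi> t \<in> filt c t \<rightarrow>\<^sub>M count_space (states c)"
    using measurable_ctrl_state[OF \<pi>] t by simp
  have d: "mitigate \<pi> (Suc t) \<in> filt c t \<rightarrow>\<^sub>M count_space (mitigations c)"
    and \<iota>: "insure \<pi> (Suc t) \<in> filt c t \<rightarrow>\<^sub>M count_space UNIV"
    using policyD(1,2)[OF \<pi> t'] by simp_all
  have "(\<lambda>\<omega>. (ctrl_state c \<pi> t \<omega>, mitigate \<pi> (Suc t) \<omega>, insure \<pi> (Suc t) \<omega>)) \<in> filt c t \<rightarrow>\<^sub>M
      count_space (states c) \<Otimes>\<^sub>M (count_space (mitigations c) \<Otimes>\<^sub>M count_space UNIV)"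
    by (intro measurable_Pair X d \<iota>)
  also have "count_space (states c) \<Otimes>\<^sub>M (count_space (mitigations c) \<Otimes>\<^sub>M count_space (UNIV :: bool set))
      = count_space (states c \<times> mitigations c \<times> UNIV)"
    using countable_finite[OF finite_states] countable_finite[OF finite_mitigations]
    by (simp add: pair_measure_countable)
  finally show ?thesis .
qed

lemma expected_best_cost_ctrl:
  assumes \<pi>: "\<pi> \<in> policies c" and t: "t < horizon c"
  defines "best \<equiv> \<lambda>\<omega>. best_cost c V (Suc t) (fst (ctrl_state c \<pi> t \<omega>)) (snd (ctrl_state c \<pi> t \<omega>))
    (mitigate \<pi> (Suc t) \<omega>) (insure \<pi> (Suc t) \<omega>)"
  shows "ennreal (exp (- rate c)) * (\<integral>\<^sup>+\<omega>. ennreal (best \<omega> (\<omega> (Suc t))) \<partial>prob_law c) =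
    (\<integral>\<^sup>+\<omega>. ennreal (exp (- rate c)) * (\<integral>\<^sup>+\<omega>'. ennreal (best \<omega> (\<omega>' (Suc t))) \<partial>prob_law c) \<partial>prob_law c)"
proof -
  let ?K = "states c \<times> mitigations c \<times> (UNIV :: bool set)"
  let ?h = "\<lambda>k w. ennreal (best_cost c V (Suc t) (fst (fst k)) (snd (fst k)) (fst (snd k)) (snd (snd k)) w)"
  let ?Y = "\<lambda>\<omega>. (ctrl_state c \<pi> t \<omega>, mitigate \<pi> (Suc t) \<omega>, insure \<pi> (Suc t) \<omega>)"
  have t': "Suc t \<in> {1..horizon c}" using t by simp
  have Y: "?Y \<in> filt c (Suc t - 1) \<rightarrow>\<^sub>M count_space ?K"
    using measurable_decision[OF \<pi> t] by simp
  have K: "finite ?K"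
    by (intro finite_cartesian_product finite_levels finite_contracts finite_mitigations) simp
  have h: "?h k \<in> borel_measurable loss_space" if "k \<in> ?K" for k
    using that measurable_best_cost[OF _ t'] by (intro measurable_compose[OF _ measurable_ennreal]) auto
  have "?Y \<in> prob_law c \<rightarrow>\<^sub>M count_space ?K"
    using filt_measurable[OF _ measurable_decision[OF \<pi> t]] t by simp
  then have "(\<lambda>\<omega>. \<integral>\<^sup>+\<omega>'. ?h (?Y \<omega>) (\<omega>' (Suc t)) \<partial>prob_law c) \<in> borel_measurable (prob_law c)"
    by (rule measurable_compose) simp
  from nn_integral_cmult[OF this, of "ennreal (exp (- rate c))"]
  show ?thesis
    using freezing[where h="?h", OF Y K t' h] unfolding best_def by simp
qed

text \<open>
  One step of the verification argument.  The Bellman inequality is applied scenario by scenario to the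
  state and the early decisions, with an independent copy \<open>\<omega>'\<close> of the new loss; freezing replaces the
  copy by the loss itself, and only then does the actual claim decision enter.
\<close>

lemma expected_V_le_step:
  assumes \<pi>: "\<pi> \<in> policies c" and t: "t < horizon c"
  shows "expected_V \<pi> t \<le> ennreal (exp (- rate c)) *
    (\<integral>\<^sup>+\<omega>. ennreal (incurred_cost c \<pi> (Suc t) \<omega> + (case ctrl_state c \<pi> (Suc t) \<omega> of (b, i) \<Rightarrow> V (Suc t) b i)) \<partial>prob_law c)"
proof -
  let ?b = "\<lambda>\<omega>. fst (ctrl_state c \<pi> t \<omega>)" and ?i = "\<lambda>\<omega>. snd (ctrl_state c \<pi> t \<omega>)"
  let ?d = "mitigate \<pi> (Suc t)" and ?\<iota> = "insure \<pi> (Suc t)"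
  have t': "Suc t \<in> {1..horizon c}" using t by simp
  have "expected_V \<pi> t \<le> (\<integral>\<^sup>+\<omega>. ennreal (exp (- rate c)) *
      (\<integral>\<^sup>+\<omega>'. ennreal (best_cost c V (Suc t) (?b \<omega>) (?i \<omega>) (?d \<omega>) (?\<iota> \<omega>) (\<omega>' (Suc t))) \<partial>prob_law c) \<partial>prob_law c)"
  proof (intro nn_integral_mono)
    fix \<omega> assume \<omega>: "\<omega> \<in> space (prob_law c)"
    have "?b \<omega> \<in> levels c" "?i \<omega> \<in> contracts c"
      using ctrl_state_in_states[OF \<pi> _ \<omega>, of t] t by (auto simp: mem_Times_iff)
    from bellman_le[OF t' this mitigate_in_mitigations[OF \<pi> t' \<omega>], of "?\<iota> \<omega>"]
    show "ennreal (case ctrl_state c \<pi> t \<omega> of (b, i) \<Rightarrow> V t b i) \<le> ennreal (exp (- rate c)) *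
      (\<integral>\<^sup>+\<omega>'. ennreal (best_cost c V (Suc t) (?b \<omega>) (?i \<omega>) (?d \<omega>) (?\<iota> \<omega>) (\<omega>' (Suc t))) \<partial>prob_law c)"
      by (simp add: split_beta)
  qed
  also have "\<dots> = ennreal (exp (- rate c)) *
      (\<integral>\<^sup>+\<omega>. ennreal (best_cost c V (Suc t) (?b \<omega>) (?i \<omega>) (?d \<omega>) (?\<iota> \<omega>) (\<omega> (Suc t))) \<partial>prob_law c)"
    by (rule expected_best_cost_ctrl[OF \<pi> t, symmetric])
  also have "\<dots> \<le> ennreal (exp (- rate c)) *
    (\<integral>\<^sup>+\<omega>. ennreal (incurred_cost c \<pi> (Suc t) \<omega> + (case ctrl_state c \<pi> (Suc t) \<omega> of (b, i) \<Rightarrow> V (Suc t) b i)) \<partial>prob_law c)"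
    using policyD(4)[OF \<pi> t'] unfolding cost_to_go_ctrl[symmetric]
    by (intro mult_left_mono nn_integral_mono ennreal_leI best_cost_le) auto
  finally show ?thesis .
qed

lemma expected_incurred_cost_plus_V:
  assumes \<pi>: "\<pi> \<in> policies c" and t: "t < horizon c"
  shows "(\<integral>\<^sup>+\<omega>. ennreal (incurred_cost c \<pi> (Suc t) \<omega> + (case ctrl_state c \<pi> (Suc t) \<omega> of (b, i) \<Rightarrow> V (Suc t) b i)) \<partial>prob_law c)
    = (\<integral>\<^sup>+\<omega>. ennreal (incurred_cost c \<pi> (Suc t) \<omega>) \<partial>prob_law c) + expected_V \<pi> (Suc t)"
proof -
  have t': "Suc t \<in> {1..horizon c}" "Suc t \<le> horizon c" using t by auto
  have [measurable]: "incurred_cost c \<pi> (Suc t) \<in> borel_measurable (prob_law c)"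
    "(\<lambda>\<omega>. case ctrl_state c \<pi> (Suc t) \<omega> of (b, i) \<Rightarrow> V (Suc t) b i) \<in> borel_measurable (prob_law c)"
    by (rule measurable_incurred_cost[OF \<pi> t'(1)]) (rule measurable_V_ctrl[OF \<pi> t'(2)])
  have "(\<integral>\<^sup>+\<omega>. ennreal (incurred_cost c \<pi> (Suc t) \<omega> + (case ctrl_state c \<pi> (Suc t) \<omega> of (b, i) \<Rightarrow> V (Suc t) b i)) \<partial>prob_law c)
      = (\<integral>\<^sup>+\<omega>. ennreal (incurred_cost c \<pi> (Suc t) \<omega>) + ennreal (case ctrl_state c \<pi> (Suc t) \<omega> of (b, i) \<Rightarrow> V (Suc t) b i) \<partial>prob_law c)"
    by (intro nn_integral_cong ennreal_plus incurred_cost_nonneg[OF \<pi> t'(1)] V_ctrl_nonneg[OF \<pi> t'(2)])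
  also have "\<dots> = (\<integral>\<^sup>+\<omega>. ennreal (incurred_cost c \<pi> (Suc t) \<omega>) \<partial>prob_law c) + expected_V \<pi> (Suc t)"
    by (rule nn_integral_add) measurable
  finally show ?thesis .
qed

lemma expected_future_cost_step:
  assumes \<pi>: "\<pi> \<in> policies c" and t: "t < horizon c"
  shows "(\<integral>\<^sup>+\<omega>. ennreal (future_cost c \<pi> t \<omega>) \<partial>prob_law c) = ennreal (exp (- rate c)) *
    ((\<integral>\<^sup>+\<omega>. ennreal (incurred_cost c \<pi> (Suc t) \<omega>) \<partial>prob_law c) +
     (\<integral>\<^sup>+\<omega>. ennreal (future_cost c \<pi> (Suc t) \<omega>) \<partial>prob_law c))"
proof -
  have t': "Suc t \<in> {1..horizon c}" "Suc t \<le> horizon c" using t by auto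
  have [measurable]: "incurred_cost c \<pi> (Suc t) \<in> borel_measurable (prob_law c)"
    "future_cost c \<pi> (Suc t) \<in> borel_measurable (prob_law c)"
    by (rule measurable_incurred_cost[OF \<pi> t'(1)]) (rule measurable_future_cost[OF \<pi> t'(2)])
  have "(\<integral>\<^sup>+\<omega>. ennreal (future_cost c \<pi> t \<omega>) \<partial>prob_law c) = (\<integral>\<^sup>+\<omega>. ennreal (exp (- rate c)) *
      (ennreal (incurred_cost c \<pi> (Suc t) \<omega>) + ennreal (future_cost c \<pi> (Suc t) \<omega>)) \<partial>prob_law c)"
    using incurred_cost_nonneg[OF \<pi> t'(1)] future_cost_nonneg[OF \<pi> _ t'(2)]
    by (intro nn_integral_cong) (simp add: future_cost_step[OF t] ennreal_mult flip: ennreal_plus)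
  also have "\<dots> = ennreal (exp (- rate c)) * (\<integral>\<^sup>+\<omega>.
      ennreal (incurred_cost c \<pi> (Suc t) \<omega>) + ennreal (future_cost c \<pi> (Suc t) \<omega>) \<partial>prob_law c)"
    by (rule nn_integral_cmult) measurable
  also have "(\<integral>\<^sup>+\<omega>. ennreal (incurred_cost c \<pi> (Suc t) \<omega>) + ennreal (future_cost c \<pi> (Suc t) \<omega>) \<partial>prob_law c) =
     (\<integral>\<^sup>+\<omega>. ennreal (incurred_cost c \<pi> (Suc t) \<omega>) \<partial>prob_law c) +
     (\<integral>\<^sup>+\<omega>. ennreal (future_cost c \<pi> (Suc t) \<omega>) \<partial>prob_law c)"
    by (rule nn_integral_add) measurable
  finally show ?thesis .
qed

lemma expected_V_horizon:
  assumes "\<pi> \<in> policies c"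
  shows "expected_V \<pi> (horizon c) = 0"
proof -
  have "expected_V \<pi> (horizon c) = (\<integral>\<^sup>+\<omega>. 0 \<partial>prob_law c)"
    using ctrl_state_in_states[OF assms order_refl]
    by (intro nn_integral_cong) (auto simp: V_horizon mem_Times_iff split_beta)
  then show ?thesis by simp
qed

lemma expected_V_initial: "expected_V \<pi> 0 = ennreal (V 0 0 No)"
  by (simp add: P.emeasure_space_1)

lemma expected_V_le_future_cost:
  assumes \<pi>: "\<pi> \<in> policies c"
  shows "t \<le> horizon c \<Longrightarrow> expected_V \<pi> t \<le> (\<integral>\<^sup>+\<omega>. ennreal (future_cost c \<pi> t \<omega>) \<partial>prob_law c)"
proof (induction t rule: inc_induct)
  case base
  show ?case unfolding expected_V_horizon[OF \<pi>] by simp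
next
  case (step t)
  then have t: "t < horizon c" by simp
  show ?case
    using expected_V_le_step[OF \<pi> t] step.IH
    unfolding expected_future_cost_step[OF \<pi> t] expected_incurred_cost_plus_V[OF \<pi> t]
    by (meson add_left_mono mult_left_mono order_trans zero_le)
qed

section \<open>Optimality of the computed policy\<close>

abbreviation "opt \<equiv> alg_policy c V dh ih"

lemma measurable_alg_claim:
  assumes b: "b \<in> levels c" and t: "t \<in> {1..horizon c}"
  shows "alg_claim c V dh ih t b i \<in> loss_space \<rightarrow>\<^sub>M count_space UNIV"
proof -
  let ?x = "\<lambda>w. compensation c b t (mitigated_loss c (dh t b i) w)"
  have "(\<lambda>w. BM c b (?x w)) \<in> loss_space \<rightarrow>\<^sub>M count_space UNIV"
    by (rule measurable_BM[OF b _ compensation_bounds(1)[OF b t mitigated_loss_nonneg]]) measurable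
  then have [measurable]: "(\<lambda>w. V t (BM c b (?x w)) On) \<in> borel_measurable loss_space"
    by (rule measurable_compose) simp
  have "(\<lambda>w. ih t b i \<and> V t (BM c b (?x w)) On - V t (bm_min c b) On < ?x w)
      \<in> loss_space \<rightarrow>\<^sub>M count_space UNIV"
    by measurable
  then show ?thesis
    by (rule measurable_cong[THEN iffD1, rotated]) (rule alg_claim_iff[OF b t, symmetric])
qed

lemma measurable_opt_decisions:
  assumes t: "t \<in> {1..horizon c}"
    and X: "alg_state c V dh ih (t - 1) \<in> filt c (t - 1) \<rightarrow>\<^sub>M count_space (states c)"
  shows "mitigate opt t \<in> filt c (t - 1) \<rightarrow>\<^sub>M count_space (mitigations c)"
    "insure opt t \<in> filt c (t - 1) \<rightarrow>\<^sub>M count_space UNIV"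
    "claim opt t \<in> filt c t \<rightarrow>\<^sub>M count_space UNIV"
proof -
  have "(\<lambda>(b, i). dh t b i) \<in> count_space (states c) \<rightarrow>\<^sub>M count_space (mitigations c)"
    using dh_mitigation[OF t] by auto
  from measurable_compose[OF X this] show "mitigate opt t \<in> filt c (t - 1) \<rightarrow>\<^sub>M count_space (mitigations c)"
    by (simp add: alg_policy_def)
  have "(\<lambda>(b, i). ih t b i) \<in> count_space (states c) \<rightarrow>\<^sub>M count_space UNIV"
    by auto
  from measurable_compose[OF X this] show "insure opt t \<in> filt c (t - 1) \<rightarrow>\<^sub>M count_space UNIV"
    by (simp add: alg_policy_def)
  have coord: "(\<lambda>\<omega>. \<omega> t) \<in> filt c t \<rightarrow>\<^sub>M loss_space"
    using t by (intro measurable_coordinate_filt) auto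
  have fixed: "(\<lambda>\<omega>. alg_claim c V dh ih t (fst x) (snd x) (\<omega> t)) \<in> filt c t \<rightarrow>\<^sub>M count_space UNIV"
    if "x \<in> states c" for x
    using that by (intro measurable_compose[OF coord measurable_alg_claim] t) auto
  have X': "alg_state c V dh ih (t - 1) \<in> filt c t \<rightarrow>\<^sub>M count_space (states c)"
    by (rule filt_mono[OF _ X]) simp
  from fixed have "(\<lambda>\<omega>. alg_claim c V dh ih t (fst (alg_state c V dh ih (t - 1) \<omega>))
      (snd (alg_state c V dh ih (t - 1) \<omega>)) (\<omega> t)) \<in> filt c t \<rightarrow>\<^sub>M count_space UNIV"
    by (rule measurable_compose_countable'[where f="\<lambda>x \<omega>. alg_claim c V dh ih t (fst x) (snd x) (\<omega> t)", OF _ X'])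
      (assumption, rule countable_finite[OF finite_states])
  then show "claim opt t \<in> filt c t \<rightarrow>\<^sub>M count_space UNIV"
    by (simp add: alg_policy_def split_beta)
qed

lemma measurable_alg_state:
  "t \<le> horizon c \<Longrightarrow> alg_state c V dh ih t \<in> filt c t \<rightarrow>\<^sub>M count_space (states c)"
proof (induction t)
  case 0
  have "alg_state c V dh ih 0 = (\<lambda>_. (0, No))" by auto
  then show ?case using initial_state by simp
next
  case (Suc t)
  then have t: "Suc t \<in> {1..horizon c}" and X: "alg_state c V dh ih (Suc t - 1) \<in> filt c (Suc t - 1) \<rightarrow>\<^sub>M count_space (states c)"
    by simp_all
  from measurable_transition_filt[OF t X measurable_opt_decisions[OF t X]]
  show ?case
    by (simp add: alg_policy_def split_beta Let_def)
qed

text \<open>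
  Admissibility and measurability of the controlled states depend on each other: the decisions of
  year \<open>t\<close> are functions of the state of year \<open>t - 1\<close>, whose measurability rests on the earlier decisions.
  The induction is carried out in \<open>measurable_alg_state\<close>.
\<close>

lemma opt_admissible: "opt \<in> policies c"
proof -
  have "\<not> (\<not> insure opt t \<omega> \<and> claim opt t \<omega>)" for t \<omega>
    by (auto simp: alg_policy_def alg_claim_def split_beta)
  then show ?thesis
    unfolding policies_def using measurable_opt_decisions measurable_alg_state by auto
qed

text \<open>
  Both inequalities of \<open>expected_V_le_step\<close> become equalities: mitigation and insurance attain the minimum
  of the expected \<open>best_cost\<close>, and the claim rule attains \<open>best_cost\<close> at every loss.
\<close>

lemma expected_V_step_opt:
  assumes t: "t < horizon c"
  shows "expected_V opt t = ennreal (exp (- rate c)) *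
    (\<integral>\<^sup>+\<omega>. ennreal (incurred_cost c opt (Suc t) \<omega> + (case ctrl_state c opt (Suc t) \<omega> of (b, i) \<Rightarrow> V (Suc t) b i)) \<partial>prob_law c)"
proof -
  let ?b = "\<lambda>\<omega>. fst (ctrl_state c opt t \<omega>)" and ?i = "\<lambda>\<omega>. snd (ctrl_state c opt t \<omega>)"
  let ?d = "mitigate opt (Suc t)" and ?\<iota> = "insure opt (Suc t)"
  have t': "Suc t \<in> {1..horizon c}" using t by simp
  have state: "?b \<omega> \<in> levels c" "?i \<omega> \<in> contracts c" if "\<omega> \<in> space (prob_law c)" for \<omega>
    using ctrl_state_in_states[OF opt_admissible _ that, of t] t by (auto simp: mem_Times_iff)
  have decision: "?d \<omega> = dh (Suc t) (?b \<omega>) (?i \<omega>)" "?\<iota> \<omega> = ih (Suc t) (?b \<omega>) (?i \<omega>)"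
    "claim opt (Suc t) \<omega> = alg_claim c V dh ih (Suc t) (?b \<omega>) (?i \<omega>) (\<omega> (Suc t))" for \<omega>
    unfolding alg_state_eq by (simp_all add: alg_policy_def split_beta)
  have "expected_V opt t = (\<integral>\<^sup>+\<omega>. ennreal (exp (- rate c)) *
      (\<integral>\<^sup>+\<omega>'. ennreal (best_cost c V (Suc t) (?b \<omega>) (?i \<omega>) (?d \<omega>) (?\<iota> \<omega>) (\<omega>' (Suc t))) \<partial>prob_law c) \<partial>prob_law c)"
  proof (intro nn_integral_cong)
    fix \<omega> assume \<omega>: "\<omega> \<in> space (prob_law c)"
    from bellman_eq[OF t' state[OF \<omega>]]
    show "ennreal (case ctrl_state c opt t \<omega> of (b, i) \<Rightarrow> V t b i) = ennreal (exp (- rate c)) *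
      (\<integral>\<^sup>+\<omega>'. ennreal (best_cost c V (Suc t) (?b \<omega>) (?i \<omega>) (?d \<omega>) (?\<iota> \<omega>) (\<omega>' (Suc t))) \<partial>prob_law c)"
      unfolding decision by (simp add: split_beta)
  qed
  also have "\<dots> = ennreal (exp (- rate c)) *
      (\<integral>\<^sup>+\<omega>. ennreal (best_cost c V (Suc t) (?b \<omega>) (?i \<omega>) (?d \<omega>) (?\<iota> \<omega>) (\<omega> (Suc t))) \<partial>prob_law c)"
    by (rule expected_best_cost_ctrl[OF opt_admissible t, symmetric])
  also have "(\<integral>\<^sup>+\<omega>. ennreal (best_cost c V (Suc t) (?b \<omega>) (?i \<omega>) (?d \<omega>) (?\<iota> \<omega>) (\<omega> (Suc t))) \<partial>prob_law c) =
    (\<integral>\<^sup>+\<omega>. ennreal (incurred_cost c opt (Suc t) \<omega> + (case ctrl_state c opt (Suc t) \<omega> of (b, i) \<Rightarrow> V (Suc t) b i)) \<partial>prob_law c)"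
  proof (intro nn_integral_cong)
    fix \<omega> assume \<omega>: "\<omega> \<in> space (prob_law c)"
    show "ennreal (best_cost c V (Suc t) (?b \<omega>) (?i \<omega>) (?d \<omega>) (?\<iota> \<omega>) (\<omega> (Suc t))) =
      ennreal (incurred_cost c opt (Suc t) \<omega> + (case ctrl_state c opt (Suc t) \<omega> of (b, i) \<Rightarrow> V (Suc t) b i))"
      unfolding cost_to_go_ctrl[symmetric] decision cost_to_go_alg_claim[OF state(1)[OF \<omega>] t'] ..
  qed
  finally show ?thesis .
qed

lemma expected_V_opt:
  "t \<le> horizon c \<Longrightarrow> expected_V opt t = (\<integral>\<^sup>+\<omega>. ennreal (future_cost c opt t \<omega>) \<partial>prob_law c)"
proof (induction t rule: inc_induct)
  case base
  show ?case unfolding expected_V_horizon[OF opt_admissible] by (simp add: future_cost_horizon)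
next
  case (step t)
  then have t: "t < horizon c" by simp
  show ?case
    unfolding expected_V_step_opt[OF t] expected_incurred_cost_plus_V[OF opt_admissible t] step.IH
      expected_future_cost_step[OF opt_admissible t] ..
qed

lemma policy_value_opt:
  assumes "\<omega> \<in> space (prob_law c)"
  shows "policy_value c opt 0 \<omega> = ennreal (V 0 0 No)"
  unfolding policy_value_0[OF opt_admissible assms] expected_V_initial[symmetric, of opt]
  by (rule expected_V_opt[symmetric]) simp

lemma optimal_value_eq:
  assumes \<omega>: "\<omega> \<in> space (prob_law c)"
  shows "optimal_value c \<omega> = ennreal (V 0 0 No)"
  unfolding optimal_value_def
proof (rule antisym)
  show "(INF \<pi>\<in>policies c. policy_value c \<pi> 0 \<omega>) \<le> ennreal (V 0 0 No)"
    using opt_admissible by (rule INF_lower2) (simp add: policy_value_opt[OF \<omega>])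
  show "ennreal (V 0 0 No) \<le> (INF \<pi>\<in>policies c. policy_value c \<pi> 0 \<omega>)"
  proof (rule INF_greatest)
    fix \<pi> assume \<pi>: "\<pi> \<in> policies c"
    show "ennreal (V 0 0 No) \<le> policy_value c \<pi> 0 \<omega>"
      unfolding policy_value_0[OF \<pi> \<omega>] expected_V_initial[symmetric, of \<pi>]
      by (rule expected_V_le_future_cost[OF \<pi>]) simp
  qed
qed

end

section \<open>Transition kernels, occupancies and quantities of interest\<close>

lemma (in prob_space) prob_partition:
  assumes X: "X \<in> M \<rightarrow>\<^sub>M count_space S" and S: "finite S"
    and B: "{\<omega> \<in> space M. B \<omega>} \<in> events"
  shows "\<P>(\<omega> in M. B \<omega>) = (\<Sum>x\<in>S. \<P>(\<omega> in M. X \<omega> = x \<and> B \<omega>))"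
proof -
  have "{\<omega> \<in> space M. X \<omega> = x \<and> B \<omega>} \<in> events" if "x \<in> S" for x
  proof -
    have "{\<omega> \<in> space M. X \<omega> = x \<and> B \<omega>} = (X -` {x} \<inter> space M) \<inter> {\<omega> \<in> space M. B \<omega>}"
      by auto
    then show ?thesis
      using measurable_sets[OF X, of "{x}"] that B by auto
  qed
  then have "prob (\<Union>x\<in>S. {\<omega> \<in> space M. X \<omega> = x \<and> B \<omega>}) = (\<Sum>x\<in>S. \<P>(\<omega> in M. X \<omega> = x \<and> B \<omega>))"
    using S by (intro finite_measure_finite_Union) (auto simp: disjoint_family_on_def)
  moreover have "(\<Union>x\<in>S. {\<omega> \<in> space M. X \<omega> = x \<and> B \<omega>}) = {\<omega> \<in> space M. B \<omega>}"
    using measurable_space[OF X] by auto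
  ultimately show ?thesis by simp
qed

context algorithm_run
begin

definition move :: "nat \<Rightarrow> int \<times> contract \<Rightarrow> loss \<Rightarrow> int \<times> contract" where
  "move t x w = (case x of (b, i) \<Rightarrow>
     transition c t b i (dh t b i) (ih t b i) (alg_claim c V dh ih t b i w) w)"

lemma alg_state_move:
  "t \<ge> 1 \<Longrightarrow> alg_state c V dh ih t \<omega> = move t (alg_state c V dh ih (t - 1) \<omega>) (\<omega> t)"
  by (cases t) (simp_all add: move_def Let_def)

lemma measurable_move:
  assumes t: "t \<in> {1..horizon c}" and x: "x \<in> states c"
  shows "move t x \<in> loss_space \<rightarrow>\<^sub>M count_space (states c)"
proof -
  obtain b i where bi: "x = (b, i)" "b \<in> levels c" "i \<in> contracts c" using x by auto
  show ?thesis
    unfolding move_def[abs_def] bi prod.case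
    by (rule measurable_compose_countable'[where
          f="\<lambda>j w. transition c t b i (dh t b i) (ih t b i) j w" and I = UNIV,
          OF measurable_transition[OF bi(2,3) t] measurable_alg_claim[OF bi(2) t]]) simp
qed

lemma measurable_move_event:
  assumes t: "t \<in> {1..horizon c}" and x: "x \<in> states c"
  shows "{w \<in> space loss_space. move t x w = y} \<in> sets loss_space"
proof (cases "y \<in> states c")
  case True
  then have "move t x -` {y} \<inter> space loss_space \<in> sets loss_space"
    by (intro measurable_sets[OF measurable_move[OF t x]]) simp
  then show ?thesis by (simp add: vimage_def Int_def conj_commute)
next
  case False
  then have "{w \<in> space loss_space. move t x w = y} = {}"
    using measurable_space[OF measurable_move[OF t x]] by auto
  then show ?thesis by (simp only: sets.empty_sets)
qed

lemma measurable_coordinate_move: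
  assumes t: "t \<in> {1..horizon c}" and x: "x \<in> states c"
  shows "(\<lambda>\<omega>. move t x (\<omega> t)) \<in> prob_law c \<rightarrow>\<^sub>M count_space (states c)"
  by (rule measurable_compose[OF measurable_coordinate[OF t] measurable_move[OF t x]])

text \<open>
  A claim that leads back to the lowest level is indistinguishable, in the state, from no claim;
  every other level identifies both the claim and the region in which the compensation lies.
\<close>

lemma move_insured_iff:
  assumes t: "t \<in> {1..horizon c}" and b: "b \<in> levels c" and ins: "ih t b i"
  defines "x \<equiv> \<lambda>w. compensation c b t (mitigated_loss c (dh t b i) w)"
  shows "bm_min c b \<noteq> b' \<Longrightarrow> move t (b, i) w = (b', On) \<longleftrightarrow> x w \<in> claim_region c V t b b'"
    and "move t (b, i) w \<in> {bm_min c b..bm_max c b} \<times> {On}"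
proof -
  have x: "0 \<le> x w"
    unfolding x_def by (rule compensation_bounds(1)[OF b t mitigated_loss_nonneg])
  have move: "move t (b, i) w =
      (if V t (BM c b (x w)) On - V t (bm_min c b) On < x w then BM c b (x w) else bm_min c b, On)"
    using ins by (simp add: move_def transition_def alg_claim_iff[OF b t] x_def bm_min_def)
  show "move t (b, i) w = (b', On) \<longleftrightarrow> x w \<in> claim_region c V t b b'" if "bm_min c b \<noteq> b'"
    unfolding move claim_region_def claim_threshold_def using that x by auto
  show "move t (b, i) w \<in> {bm_min c b..bm_max c b} \<times> {On}"
    unfolding move using BM_between[OF b x] BM_between[OF b, of 0] by (auto simp: bm_min_def)
qed

text \<open>
  For an insured agent the next level lies in a finite interval, so the probabilities of all levels add up to
  one; this justifies filling in the lowest level by the complement.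
\<close>

lemma alg_kernel_eq_prob_move:
  assumes t: "t \<in> {1..horizon c}" and x: "x \<in> states c"
  shows "alg_kernel c V dh ih t x y = \<P>(\<omega> in prob_law c. move t x (\<omega> t) = y)"
proof -
  obtain b i where bi: "x = (b, i)" "b \<in> levels c" "i \<in> contracts c" using x by auto
  obtain b' i' where y: "y = (b', i')" by (cases y)
  show ?thesis
  proof (cases "ih t b i")
    case False
    then have "move t x w = BM0 c b i" for w
      by (simp add: bi move_def transition_def)
    then show ?thesis
      using False by (auto simp: bi y alg_kernel_def P.prob_space)
  next
    case True
    note iff = move_insured_iff[OF t bi(2) True, folded bi(1)]
    let ?up = "\<lambda>b'. \<P>(\<omega> in prob_law c.
        compensation c b t (mitigated_loss c (dh t b i) (\<omega> t)) \<in> claim_region c V t b b')"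
    let ?q = "\<lambda>b'. \<P>(\<omega> in prob_law c. move t x (\<omega> t) = (b', On))"
    have up: "?up b' = ?q b'" if "b' \<in> {bm_min c b<..bm_max c b}" for b'
      using that iff(1)[of b'] by simp
    have level: "(\<lambda>\<omega>. fst (move t x (\<omega> t))) \<in> prob_law c \<rightarrow>\<^sub>M count_space {bm_min c b..bm_max c b}"
    proof -
      have "(\<lambda>\<omega>. fst (move t x (\<omega> t))) \<in> prob_law c \<rightarrow>\<^sub>M count_space UNIV"
        by (rule measurable_compose[OF measurable_coordinate_move[OF t x]]) simp
      then show ?thesis
        unfolding measurable_count_space_eq2[OF finite_atLeastAtMost_int]
        using measurable_sets[of "\<lambda>\<omega>. fst (move t x (\<omega> t))"] iff(2) by (auto simp: mem_Times_iff)
    qed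
    have "1 = (\<Sum>b'\<in>{bm_min c b..bm_max c b}. \<P>(\<omega> in prob_law c. fst (move t x (\<omega> t)) = b' \<and> True))"
      using P.prob_partition[OF level finite_atLeastAtMost_int, of "\<lambda>_. True"] P.prob_space by simp
    also have "\<dots> = (\<Sum>b'\<in>{bm_min c b..bm_max c b}. ?q b')"
    proof (intro sum.cong refl)
      fix b'
      have "fst (move t x (\<omega> t)) = b' \<and> True \<longleftrightarrow> move t x (\<omega> t) = (b', On)" for \<omega>
        using iff(2)[of "\<omega> t"] by (auto simp: prod_eq_iff mem_Times_iff)
      then show "\<P>(\<omega> in prob_law c. fst (move t x (\<omega> t)) = b' \<and> True) = ?q b'" by presburger
    qed
    also have "{bm_min c b..bm_max c b} = insert (bm_min c b) {bm_min c b<..bm_max c b}"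
      using BM_between[OF bi(2), of 0] by auto
    finally have total: "1 = ?q (bm_min c b) + (\<Sum>b'\<in>{bm_min c b<..bm_max c b}. ?q b')"
      by simp
    have zero: "\<P>(\<omega> in prob_law c. move t x (\<omega> t) = y) = 0"
      if "\<not> (i' = On \<and> b' \<in> {bm_min c b..bm_max c b})"
    proof -
      have "y \<notin> {bm_min c b..bm_max c b} \<times> {On}"
        using that unfolding y by blast
      then have "move t x (\<omega> t) \<noteq> y" for \<omega>
        using iff(2)[of "\<omega> t"] by metis
      then have "{\<omega> \<in> space (prob_law c). move t x (\<omega> t) = y} = {}"
        by blast
      then show ?thesis by (simp only: measure_empty)
    qed
    have kernel: "alg_kernel c V dh ih t x y =
        (if i' = On \<and> b' \<in> {bm_min c b<..bm_max c b} then ?up b'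
         else if i' = On \<and> b' = bm_min c b then 1 - (\<Sum>b''\<in>{bm_min c b<..bm_max c b}. ?up b'')
         else 0)"
      using True by (simp add: bi y alg_kernel_def)
    consider "i' = On" "b' \<in> {bm_min c b<..bm_max c b}" | "i' = On" "b' = bm_min c b"
      | "\<not> (i' = On \<and> b' \<in> {bm_min c b..bm_max c b})" "\<not> (i' = On \<and> b' \<in> {bm_min c b<..bm_max c b})"
        "\<not> (i' = On \<and> b' = bm_min c b)"
      by force
    then show ?thesis
    proof cases
      case 1
      have "alg_kernel c V dh ih t x y = ?up b'"
        unfolding kernel using 1 by simp
      also have "\<dots> = ?q b'" using 1(2) by (rule up)
      finally show ?thesis unfolding y 1(1) .
    next
      case 2
      have "(\<Sum>b''\<in>{bm_min c b<..bm_max c b}. ?up b'') = (\<Sum>b''\<in>{bm_min c b<..bm_max c b}. ?q b'')"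
        by (intro sum.cong refl up)
      moreover have "alg_kernel c V dh ih t x y = 1 - (\<Sum>b''\<in>{bm_min c b<..bm_max c b}. ?up b'')"
        unfolding kernel using 2 by simp
      ultimately show ?thesis unfolding y 2 using total by simp
    next
      case 3
      have "alg_kernel c V dh ih t x y = 0"
        unfolding kernel if_not_P[OF 3(2)] if_not_P[OF 3(3)] ..
      then show ?thesis using zero[OF 3(1)] by simp
    qed
  qed
qed

lemma past_state_event:
  assumes t: "t \<le> horizon c"
  shows "{\<omega> \<in> space (prob_law c). alg_state c V dh ih t \<omega> = x} \<in> sets (filt c t)"
proof (cases "x \<in> states c")
  case True
  then have "alg_state c V dh ih t -` {x} \<inter> space (filt c t) \<in> sets (filt c t)"
    by (intro measurable_sets[OF measurable_alg_state[OF t]]) simp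
  then show ?thesis by (simp add: vimage_def Int_def conj_commute)
next
  case False
  then have "{\<omega> \<in> space (prob_law c). alg_state c V dh ih t \<omega> = x} = {}"
    using measurable_space[OF measurable_alg_state[OF t]] by auto
  then show ?thesis by (simp only: sets.empty_sets)
qed

text \<open>
  The Markov property: the previous state is a past event, and given it the next state depends on the
  new loss only.
\<close>

lemma prob_consecutive_states:
  assumes t: "t \<in> {1..horizon c}" and x: "x \<in> states c"
  shows "\<P>(\<omega> in prob_law c. alg_state c V dh ih (t - 1) \<omega> = x \<and> alg_state c V dh ih t \<omega> = y) =
    alg_kernel c V dh ih t x y * \<P>(\<omega> in prob_law c. alg_state c V dh ih (t - 1) \<omega> = x)"
proof -
  let ?A = "{\<omega> \<in> space (prob_law c). alg_state c V dh ih (t - 1) \<omega> = x}"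
  have A: "?A \<in> sets (filt c (t - 1))"
    using t by (intro past_state_event) auto
  have "{\<omega> \<in> space (prob_law c). alg_state c V dh ih (t - 1) \<omega> = x \<and> alg_state c V dh ih t \<omega> = y}
      = {\<omega> \<in> space (prob_law c). \<omega> \<in> ?A \<and> move t x (\<omega> t) = y}"
    using t by (auto simp: alg_state_move)
  then show ?thesis
    using prob_past_and_loss[OF A t measurable_move_event[OF t x]]
    by (simp add: alg_kernel_eq_prob_move[OF t x])
qed

lemma alg_occupancy_eq:
  "t \<le> horizon c \<Longrightarrow> alg_occupancy c V dh ih t y = \<P>(\<omega> in prob_law c. alg_state c V dh ih t \<omega> = y)"
proof (induction t arbitrary: y)
  case 0
  then show ?case by (auto simp: P.prob_space)
next
  case (Suc t)
  then have t: "Suc t \<in> {1..horizon c}" "t \<le> horizon c" by auto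
  have X: "alg_state c V dh ih t \<in> prob_law c \<rightarrow>\<^sub>M count_space (states c)"
    by (rule filt_measurable[OF t(2) measurable_alg_state[OF t(2)]])
  have Y: "{\<omega> \<in> space (prob_law c). alg_state c V dh ih (Suc t) \<omega> = y} \<in> sets (prob_law c)"
    using past_state_event[OF Suc.prems] sets_filt_subset[OF Suc.prems] by blast
  have "\<P>(\<omega> in prob_law c. alg_state c V dh ih (Suc t) \<omega> = y) =
      (\<Sum>x\<in>states c. \<P>(\<omega> in prob_law c. alg_state c V dh ih t \<omega> = x \<and> alg_state c V dh ih (Suc t) \<omega> = y))"
    by (rule P.prob_partition[OF X finite_states Y])
  also have "\<dots> = (\<Sum>x\<in>states c. alg_kernel c V dh ih (Suc t) x y * alg_occupancy c V dh ih t x)"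
    using prob_consecutive_states[OF t(1)] Suc.IH[OF t(2)] by (intro sum.cong refl) simp
  finally show ?case by simp
qed

lemma alg_kernel_eq_cond_prob:
  assumes t: "t \<in> {1..horizon c}" and x: "x \<in> states c"
    and pos: "\<P>(\<omega> in prob_law c. alg_state c V dh ih (t - 1) \<omega> = x) > 0"
  shows "alg_kernel c V dh ih t x y =
    \<P>(\<omega> in prob_law c. alg_state c V dh ih t \<omega> = y \<bar> alg_state c V dh ih (t - 1) \<omega> = x)"
  using prob_consecutive_states[OF t x, of y] pos unfolding cond_prob_def by (simp add: conj_commute)

text \<open>
  The quantity of interest of year \<open>t\<close> is evaluated at the state of year \<open>t - 1\<close>, which is independent of the
  new loss; so its expectation is the sum over the states of products.
\<close>

lemma alg_zeta_eq:
  assumes t: "t \<in> {1..horizon c}"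
    and meas: "\<And>b i. b \<in> levels c \<Longrightarrow> i \<in> contracts c \<Longrightarrow> \<zeta> t b i \<in> borel_measurable loss_space"
    and int: "\<And>b i. b \<in> levels c \<Longrightarrow> i \<in> contracts c \<Longrightarrow> integrable (prob_law c) (\<lambda>\<omega>. \<zeta> t b i (\<omega> t))"
  shows "integrable (prob_law c) (\<lambda>\<omega>. case alg_state c V dh ih (t - 1) \<omega> of (b, i) \<Rightarrow> \<zeta> t b i (\<omega> t))"
    and "alg_zeta c V dh ih \<zeta> t =
      (\<integral>\<omega>. (case alg_state c V dh ih (t - 1) \<omega> of (b, i) \<Rightarrow> \<zeta> t b i (\<omega> t)) \<partial>prob_law c)"
proof -
  let ?X = "alg_state c V dh ih (t - 1)"
  let ?f = "\<lambda>\<omega>. case ?X \<omega> of (b, i) \<Rightarrow> \<zeta> t b i (\<omega> t)"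
  let ?A = "\<lambda>x. {\<omega> \<in> space (prob_law c). ?X \<omega> = x}"
  let ?z = "\<lambda>x w. \<zeta> t (fst x) (snd x) w"
  let ?g = "\<lambda>\<omega>. \<Sum>x\<in>states c. indicator (?A x) \<omega> * ?z x (\<omega> t)"
  have le: "t - 1 \<le> horizon c" using t by auto
  have eq: "?f \<omega> = ?g \<omega>" if "\<omega> \<in> space (prob_law c)" for \<omega>
  proof -
    have "?X \<omega> \<in> states c"
      using measurable_space[OF measurable_alg_state[OF le], of \<omega>] that by simp
    moreover have "?g \<omega> = (\<Sum>x\<in>states c. if x = ?X \<omega> then ?z x (\<omega> t) else 0)"
      using that by (intro sum.cong) (auto simp: indicator_def)
    ultimately show ?thesis
      using finite_states[of c] by (simp add: split_beta)
  qed
  have summand: "integrable (prob_law c) (\<lambda>\<omega>. indicator (?A x) \<omega> * ?z x (\<omega> t))"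
    "(\<integral>\<omega>. indicator (?A x) \<omega> * ?z x (\<omega> t) \<partial>prob_law c)
      = P.prob (?A x) * (\<integral>\<omega>. ?z x (\<omega> t) \<partial>prob_law c)" if "x \<in> states c" for x
  proof -
    have "fst x \<in> levels c" "snd x \<in> contracts c" using that by auto
    note factors = integral_past_times_loss[OF past_state_event[OF le, of x] t meas[OF this] int[OF this]]
    show "integrable (prob_law c) (\<lambda>\<omega>. indicator (?A x) \<omega> * ?z x (\<omega> t))"
      "(\<integral>\<omega>. indicator (?A x) \<omega> * ?z x (\<omega> t) \<partial>prob_law c)
        = P.prob (?A x) * (\<integral>\<omega>. ?z x (\<omega> t) \<partial>prob_law c)"
      by (rule factors)+
  qed
  have "integrable (prob_law c) ?g"
    using summand(1) by (rule Bochner_Integration.integrable_sum)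
  then show "integrable (prob_law c) ?f"
    using eq by (simp cong: Bochner_Integration.integrable_cong)
  have "(\<integral>\<omega>. ?f \<omega> \<partial>prob_law c) = (\<integral>\<omega>. ?g \<omega> \<partial>prob_law c)"
    using eq by (rule Bochner_Integration.integral_cong[OF refl])
  also have "\<dots> = (\<Sum>x\<in>states c. \<integral>\<omega>. indicator (?A x) \<omega> * ?z x (\<omega> t) \<partial>prob_law c)"
    using summand(1) by (rule Bochner_Integration.integral_sum)
  also have "\<dots> = (\<Sum>x\<in>states c. (\<integral>\<omega>. ?z x (\<omega> t) \<partial>prob_law c) * alg_occupancy c V dh ih (t - 1) x)"
    using summand(2) alg_occupancy_eq[OF le] by (intro sum.cong refl) simp
  finally show "alg_zeta c V dh ih \<zeta> t = (\<integral>\<omega>. ?f \<omega> \<partial>prob_law c)"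
    unfolding alg_zeta_def by (simp add: split_beta)
qed

end

theorem theorem4p4:
  fixes c :: cyber_model
    and M :: nat
    and \<zeta> :: "nat \<Rightarrow> nat \<Rightarrow> int \<Rightarrow> contract \<Rightarrow> loss \<Rightarrow> real"
    and V :: "nat \<Rightarrow> int \<Rightarrow> contract \<Rightarrow> real"
    and dh :: "nat \<Rightarrow> int \<Rightarrow> contract \<Rightarrow> nat"
    and ih :: "nat \<Rightarrow> int \<Rightarrow> contract \<Rightarrow> bool"
    and \<pi> :: policy
  assumes model: "cyber_provisioning c"
    and zeta_measurable: "\<And>m t b i. m \<in> {1..M} \<Longrightarrow> t \<in> {1..horizon c} \<Longrightarrow> b \<in> levels c \<Longrightarrow>
      i \<in> contracts c \<Longrightarrow> \<zeta> m t b i \<in> borel_measurable loss_space"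
    and zeta_integrable: "\<And>m t b i. m \<in> {1..M} \<Longrightarrow> t \<in> {1..horizon c} \<Longrightarrow> b \<in> levels c \<Longrightarrow>
      i \<in> contracts c \<Longrightarrow> integrable (prob_law c) (\<lambda>\<omega>. \<zeta> m t b i (\<omega> t))"
    and run: "alg_run c V dh ih"
    and policy: "\<pi> = alg_policy c V dh ih"
  shows
    "\<pi> \<in> policies c \<and>
     (\<forall>\<omega>\<in>space (prob_law c).
        ereal (V 0 0 No) = enn2ereal (policy_value c \<pi> 0 \<omega>) \<and>
        ereal (V 0 0 No) = enn2ereal (optimal_value c \<omega>)) \<and>
     (\<forall>t\<in>{1..horizon c}. \<forall>x\<in>levels c \<times> contracts c. \<forall>y\<in>levels c \<times> contracts c.
        \<P>(\<omega> in prob_law c. ctrl_state c \<pi> (t - 1) \<omega> = x) > 0 \<longrightarrow>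
        alg_kernel c V dh ih t x y =
          \<P>(\<omega> in prob_law c. ctrl_state c \<pi> t \<omega> = y \<bar> ctrl_state c \<pi> (t - 1) \<omega> = x)) \<and>
     (\<forall>t\<in>{0..horizon c}. \<forall>x\<in>levels c \<times> contracts c.
        alg_occupancy c V dh ih t x = \<P>(\<omega> in prob_law c. ctrl_state c \<pi> t \<omega> = x)) \<and>
     (\<forall>m\<in>{1..M}.
        (\<forall>t\<in>{1..horizon c}.
           integrable (prob_law c) (\<lambda>\<omega>. case ctrl_state c \<pi> (t - 1) \<omega> of (b, i) \<Rightarrow> \<zeta> m t b i (\<omega> t)) \<and>
           alg_zeta c V dh ih (\<zeta> m) t =
             (\<integral>\<omega>. (case ctrl_state c \<pi> (t - 1) \<omega> of (b, i) \<Rightarrow> \<zeta> m t b i (\<omega> t)) \<partial>prob_law c)) \<and>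
        alg_zeta_total c V dh ih (\<zeta> m) =
          (\<Sum>t=1..horizon c.
             \<integral>\<omega>. (case ctrl_state c \<pi> (t - 1) \<omega> of (b, i) \<Rightarrow> \<zeta> m t b i (\<omega> t)) \<partial>prob_law c))"
proof -
  interpret cyber_provisioning c by (rule model)
  interpret algorithm_run c V dh ih by unfold_locales (rule run)
  have optimal: "ereal (V 0 0 No) = enn2ereal (policy_value c \<pi> 0 \<omega>) \<and>
      ereal (V 0 0 No) = enn2ereal (optimal_value c \<omega>)" if "\<omega> \<in> space (prob_law c)" for \<omega>
    using V_nonneg[of 0 0 No] initial_state[of c]
    unfolding policy policy_value_opt[OF that] optimal_value_eq[OF that] by simp
  have zeta: "integrable (prob_law c) (\<lambda>\<omega>. case ctrl_state c \<pi> (t - 1) \<omega> of (b, i) \<Rightarrow> \<zeta> m t b i (\<omega> t))"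
    "alg_zeta c V dh ih (\<zeta> m) t =
      (\<integral>\<omega>. (case ctrl_state c \<pi> (t - 1) \<omega> of (b, i) \<Rightarrow> \<zeta> m t b i (\<omega> t)) \<partial>prob_law c)"
    if "m \<in> {1..M}" "t \<in> {1..horizon c}" for m t
    unfolding policy alg_state_eq
    by (intro alg_zeta_eq zeta_measurable zeta_integrable that; assumption)+
  have total: "alg_zeta_total c V dh ih (\<zeta> m) = (\<Sum>t=1..horizon c.
      \<integral>\<omega>. (case ctrl_state c \<pi> (t - 1) \<omega> of (b, i) \<Rightarrow> \<zeta> m t b i (\<omega> t)) \<partial>prob_law c)"
    if "m \<in> {1..M}" for m
    unfolding alg_zeta_total_def using zeta(2)[OF that] by (rule sum.cong[OF refl])
  have kernel: "alg_kernel c V dh ih t x y =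
      \<P>(\<omega> in prob_law c. ctrl_state c \<pi> t \<omega> = y \<bar> ctrl_state c \<pi> (t - 1) \<omega> = x)"
    if "t \<in> {1..horizon c}" "x \<in> states c" "\<P>(\<omega> in prob_law c. ctrl_state c \<pi> (t - 1) \<omega> = x) > 0" for t x y
    using alg_kernel_eq_cond_prob[OF that(1,2)] that(3) unfolding policy alg_state_eq by blast
  have occupancy: "alg_occupancy c V dh ih t x = \<P>(\<omega> in prob_law c. ctrl_state c \<pi> t \<omega> = x)"
    if "t \<in> {0..horizon c}" for t x
    using alg_occupancy_eq[of t x] that unfolding policy alg_state_eq by simp
  have admissible: "\<pi> \<in> policies c"
    unfolding policy by (rule opt_admissible)
  show ?thesis
    by (intro conjI ballI impI admissible optimal kernel occupancy zeta total) assumption+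
qed

end
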